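(* Let $q$ be a prime, let $\varpi_1\in V_\pi$ be a cuspidal newform such that $A_{\varpi_1}(1,1)=1$, and let $p\nmid q$ be a prime. The Hecke eigenvalues $\lambda(p^r,\pi)$ of $\pi$ with respect to $T(p^r)$ are given by $$\lambda(p,\pi)=p^{3/2}A_{\varpi_1}(1,p),$$ $$\lambda(p^r,\pi)=p^{3r/2}\left(A_{\varpi_1}(1,p^r)-p^{-1}A_{\varpi_1}(1,p^{r-2})\right),\qquad r\ge2.$$
   Context: $\mathrm{Sp}(4)=\{g : g^\top J g = J\}$ with $J=\begin{pmatrix}0&I_2\\ -I_2&0\end{pmatrix}$; $K=\mathrm{SO}(4,\mathbb{R})\cap \mathrm{Sp}(4,\mathbb{R})$; $\Gamma_0(q)\subseteq\mathrm{Sp}(4,\mathbb{Z})$ consists of the matrices whose lower left $2\times2$ block is divisible by $q$. Newforms are right $K$-invariant cusp forms on $\Gamma_0(q)\backslash\mathrm{Sp}(4,\mathbb{R})/K$ (of level dividing $q$), and $\pi$ is the irreducible cuspidal automorphic representation (of $\mathrm{GSp}(4)$, trivial central character), with space $V_\pi$, corresponding to $\varpi_1$. $U$ is the unipotent subgroup of $\mathrm{Sp}(4)$ of matrices $\begin{pmatrix}1&x_{12}&x_{13}&x_{14}\\ &1&x_{23}&x_{24}\\ &&1&\\ &&x_{43}&1\end{pmatrix}$ with $x_{12}=-x_{43}$, $x_{14}=x_{23}+x_{12}x_{24}$, with Haar measure $dx=dx_{12}dx_{13}dx_{23}dx_{24}$. For $M=(M_1,M_2)$, $\theta_M(x)=e(M_1x_{12}+M_2x_{24})$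 with $e(t)=e^{2\pi i t}$, and $\theta=\theta_{(1,1)}$. For $y\in\mathbb{R}_+^2$, $\iota(y)=\mathrm{diag}(y_1y_2^{1/2},y_2^{1/2},y_1^{-1}y_2^{-1/2},y_2^{-1/2})$; $\eta=(2,3/2)$ and $M^\eta=M_1^2M_2^{3/2}$. Fourier coefficients: for an automorphic form $\varpi$ with archimedean spectral parameter $\mu$ and $M\in\mathbb{N}^2$, $A_\varpi(M)\in\mathbb{C}$ is defined by $$\int_{U(\mathbb{Z})\backslash U(\mathbb{R})}\varpi(ug)\overline{\theta_M(u)}\,du=\frac{A_\varpi(M)}{M^\eta}\,\theta_M(x)\,W_\mu(\iota(M)y)\quad\text{for } g=xyk,\ x\in U(\mathbb{R}),\ y\in\iota(\mathbb{R}_+^2),\ k\in K,$$ where $W_\mu$ is the standard spherical Whittaker function on $\mathrm{Sp}(4,\mathbb{R})$ with parameter $\mu$ with respect to $\theta$ (the moderate-growth one, unique up to a scalar, fixed once and for all). Hecke operators: let $S(m)$ be the set of integral $4\times4$ matrices $M$ with $M^\top JM=mJ$. A complete system of representatives of $\mathrm{Sp}(4,\mathbb{Z})\backslash S(m)$ is the set $\mathcal{H}(m)$ of matrices $\begin{pmatrix}A& m^{-1}BD\\ 0&D\end{pmatrix}\in S(m)$ with $A=\begin{pmatrix}a_1&a\\ 0&a_2\end{pmatrix}$, $B=\begin{pmatrix}b_1&b_2\\ b_2&b_3\end{pmatrix}$ integral, $a_1,a_2>0$, $0\le a<a_2$, $0\le b_i<m$, $AD^\top=mI_2$, $BD\equiv0\pmod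 m$. For $m$ coprime to $q$, $T(m)\varpi(g)=\sum_{h\in\mathcal{H}(m)}\varpi(hg)$ (forms being extended to $\mathrm{GSp}(4,\mathbb{R})^+$ invariantly under the centre), and $\lambda(m,\pi)$ is the eigenvalue of $T(m)$ on $\varpi_1$. *)

theory Defs
  imports "HOL-Analysis.Analysis" "HOL-Computational_Algebra.Primes"
begin

section \<open>The finite adeles of the rationals\<close>

text \<open>
  The ring of finite adeles is the completion of the rationals for the topology whose
  neighbourhoods of 0 are the subgroups N\<int> (N > 0).  It is constructed as Cauchy sequences
  modulo null sequences.
\<close>

definition qcong :: "nat \<Rightarrow> rat \<Rightarrow> rat \<Rightarrow> bool"
  where "qcong N a b \<longleftrightarrow> (\<exists>z::int. a - b = of_nat N * of_int z)"

definition fcauchy :: "(nat \<Rightarrow> rat) \<Rightarrow> bool"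
  where "fcauchy x \<longleftrightarrow> (\<forall>N>0. \<exists>k. \<forall>i\<ge>k. \<forall>j\<ge>k. qcong N (x i) (x j))"

definition fequiv :: "(nat \<Rightarrow> rat) \<Rightarrow> (nat \<Rightarrow> rat) \<Rightarrow> bool"
  where "fequiv x y \<longleftrightarrow> fcauchy x \<and> fcauchy y \<and> (\<forall>N>0. \<exists>k. \<forall>i\<ge>k. qcong N (x i) (y i))"

lemma qcong_refl [simp]: "qcong N a a"
  by (auto simp: qcong_def intro: exI[of _ 0])

lemma qcong_sym: "qcong N a b \<Longrightarrow> qcong N b a"
  unfolding qcong_def
proof (elim exE)
  fix z :: int assume "a - b = of_nat N * of_int z"
  then show "\<exists>z. b - a = of_nat N * of_int z"
    by (intro exI[of _ "-z"]) (simp add: algebra_simps)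
qed

lemma qcong_add: "qcong N a b \<Longrightarrow> qcong N c d \<Longrightarrow> qcong N (a + c) (b + d)"
  unfolding qcong_def
proof (elim exE)
  fix z w :: int assume "a - b = of_nat N * of_int z" "c - d = of_nat N * of_int w"
  then show "\<exists>z. a + c - (b + d) = of_nat N * of_int z"
    by (intro exI[of _ "z + w"]) (simp add: algebra_simps)
qed

lemma qcong_minus: "qcong N a b \<Longrightarrow> qcong N (- a) (- b)"
  unfolding qcong_def
proof (elim exE)
  fix z :: int assume "a - b = of_nat N * of_int z"
  then show "\<exists>z. - a - - b = of_nat N * of_int z"
    by (intro exI[of _ "-z"]) (simp add: algebra_simps)
qed

lemma qcong_trans: "qcong N a b \<Longrightarrow> qcong N b c \<Longrightarrow> qcong N a c"
  using qcong_add[of N a b b c] by (auto simp: qcong_def)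

lemma qcong_mult:
  assumes "qcong (N * d) a b" "qcong (N * d) a' b'"
    and "of_nat d * a' = (of_int u :: rat)" "of_nat d * b = (of_int v :: rat)"
  shows "qcong N (a * a') (b * b')"
proof -
  from assms obtain z w :: int where
    z: "a - b = of_nat (N * d) * of_int z" and w: "a' - b' = of_nat (N * d) * of_int w"
    by (auto simp: qcong_def)
  have "a * a' - b * b' = (a - b) * a' + b * (a' - b')"
    by (simp add: algebra_simps)
  also have "\<dots> = of_nat N * (of_int z * (of_nat d * a') + of_int w * (of_nat d * b))"
    unfolding z w by (simp add: algebra_simps)
  also have "\<dots> = of_nat N * of_int (z * u + w * v)"
    unfolding assms(3,4) by simp
  finally show ?thesis unfolding qcong_def by blast
qed

lemma fcauchy_denom:
  assumes "fcauchy x"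
  shows "\<exists>d>0. \<exists>k. \<forall>i\<ge>k. \<exists>u::int. of_nat d * x i = of_int u"
proof -
  from assms obtain k where k: "\<And>i j. i \<ge> k \<Longrightarrow> j \<ge> k \<Longrightarrow> qcong 1 (x i) (x j)"
    unfolding fcauchy_def by (meson zero_less_one)
  obtain a b where ab: "quotient_of (x k) = (a, b)" by force
  have b: "b > 0" and xk: "x k = of_int a / of_int b"
    using ab by (auto intro: quotient_of_denom_pos quotient_of_div)
  have "\<exists>u::int. of_nat (nat b) * x i = of_int u" if "i \<ge> k" for i
  proof -
    from k[OF that order_refl] obtain z :: int where "x i - x k = of_int z"
      by (auto simp: qcong_def)
    then have xi: "x i = of_int z + x k" by (simp add: algebra_simps)
    have "of_nat (nat b) * x i = of_int (b * z + a)"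
      using b unfolding xi xk by (simp add: algebra_simps)
    then show ?thesis by blast
  qed
  then show ?thesis using b by (intro exI[of _ "nat b"]) auto
qed

lemma fcauchy_denom2:
  assumes "fcauchy x" "fcauchy y"
  shows "\<exists>d>0. \<exists>k. \<forall>i\<ge>k. (\<exists>u::int. of_nat d * x i = of_int u) \<and> (\<exists>v::int. of_nat d * y i = of_int v)"
proof -
  from fcauchy_denom[OF assms(1)] obtain d k where d: "d > 0"
    "\<And>i. i \<ge> k \<Longrightarrow> \<exists>u::int. of_nat d * x i = of_int u" by blast
  from fcauchy_denom[OF assms(2)] obtain e l where e: "e > 0"
    "\<And>i. i \<ge> l \<Longrightarrow> \<exists>u::int. of_nat e * y i = of_int u" by blast
  have "(\<exists>u::int. of_nat (d * e) * x i = of_int u) \<and> (\<exists>v::int. of_nat (d * e) * y i = of_int v)"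
    if i: "max k l \<le> i" for i
  proof -
    from i d(2)[of i] obtain u :: int where u: "of_nat d * x i = of_int u" by auto
    from i e(2)[of i] obtain v :: int where v: "of_nat e * y i = of_int v" by auto
    have "of_nat (d * e) * x i = of_nat e * (of_nat d * x i)"
      by (simp add: algebra_simps)
    then have "of_nat (d * e) * x i = of_int (int e * u)"
      unfolding u by simp
    moreover have "of_nat (d * e) * y i = of_nat d * (of_nat e * y i)"
      by (simp add: algebra_simps)
    then have "of_nat (d * e) * y i = of_int (int d * v)"
      unfolding v by simp
    ultimately show ?thesis by blast
  qed
  moreover have "d * e > 0" using d e by simp
  ultimately show ?thesis by blast
qed

lemma fcauchy_const [simp]: "fcauchy (\<lambda>_. c)"
  by (simp add: fcauchy_def)

lemma fcauchy_add: "fcauchy x \<Longrightarrow> fcauchy y \<Longrightarrow> fcauchy (\<lambda>i. x i + y i)"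
  unfolding fcauchy_def
proof (intro allI impI)
  fix N :: nat
  assume xy: "\<forall>N>0. \<exists>k. \<forall>i\<ge>k. \<forall>j\<ge>k. qcong N (x i) (x j)"
    "\<forall>N>0. \<exists>k. \<forall>i\<ge>k. \<forall>j\<ge>k. qcong N (y i) (y j)" and N: "N > 0"
  from xy N obtain k l where "\<forall>i\<ge>k. \<forall>j\<ge>k. qcong N (x i) (x j)"
    "\<forall>i\<ge>l. \<forall>j\<ge>l. qcong N (y i) (y j)" by meson
  then show "\<exists>k. \<forall>i\<ge>k. \<forall>j\<ge>k. qcong N (x i + y i) (x j + y j)"
    by (intro exI[of _ "max k l"]) (auto intro: qcong_add)
qed

lemma fcauchy_minus: "fcauchy x \<Longrightarrow> fcauchy (\<lambda>i. - x i)"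
  unfolding fcauchy_def by (meson qcong_minus)

lemma fcauchy_mult:
  assumes "fcauchy x" "fcauchy y"
  shows "fcauchy (\<lambda>i. x i * y i)"
  unfolding fcauchy_def
proof (intro allI impI)
  fix N :: nat assume N: "N > 0"
  from fcauchy_denom2[OF assms] obtain d m where d: "d > 0"
    "\<And>i. i \<ge> m \<Longrightarrow> (\<exists>u::int. of_nat d * x i = of_int u) \<and> (\<exists>v::int. of_nat d * y i = of_int v)"
    by blast
  have Nd: "N * d > 0" using N d by simp
  from assms Nd obtain k l where k: "\<And>i j. i \<ge> k \<Longrightarrow> j \<ge> k \<Longrightarrow> qcong (N * d) (x i) (x j)"
    and l: "\<And>i j. i \<ge> l \<Longrightarrow> j \<ge> l \<Longrightarrow> qcong (N * d) (y i) (y j)"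
    unfolding fcauchy_def by metis
  show "\<exists>k. \<forall>i\<ge>k. \<forall>j\<ge>k. qcong N (x i * y i) (x j * y j)"
  proof (intro exI[of _ "max m (max k l)"] allI impI)
    fix i j assume ij: "max m (max k l) \<le> i" "max m (max k l) \<le> j"
    from ij d(2)[of i] d(2)[of j] obtain u v :: int
      where "of_nat d * y i = of_int u" "of_nat d * x j = of_int v" by auto
    then show "qcong N (x i * y i) (x j * y j)"
      using ij k l by (intro qcong_mult[of N d]) auto
  qed
qed

lemma fequiv_refl: "fcauchy x \<Longrightarrow> fequiv x x"
  by (simp add: fequiv_def)

lemma part_equivp_fequiv: "part_equivp fequiv"
proof (rule part_equivpI)
  show "\<exists>x. fequiv x x" using fequiv_refl[of "\<lambda>_. 0"] by auto
  show "symp fequiv" unfolding fequiv_def by (intro sympI) (meson qcong_sym)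
  show "transp fequiv"
  proof (rule transpI)
    fix x y z assume xy: "fequiv x y" and yz: "fequiv y z"
    have "\<exists>k. \<forall>i\<ge>k. qcong N (x i) (z i)" if "N > 0" for N
    proof -
      from xy yz that obtain k l where "\<forall>i\<ge>k. qcong N (x i) (y i)" "\<forall>i\<ge>l. qcong N (y i) (z i)"
        unfolding fequiv_def by meson
      then show ?thesis by (intro exI[of _ "max k l"]) (auto intro: qcong_trans)
    qed
    then show "fequiv x z" using xy yz by (auto simp: fequiv_def)
  qed
qed

quotient_type fadele = "nat \<Rightarrow> rat" / partial: fequiv
  by (rule part_equivp_fequiv)

instantiation fadele :: comm_ring_1
begin

lift_definition zero_fadele :: fadele is "\<lambda>_. 0" by (simp add: fequiv_refl)

lift_definition one_fadele :: fadele is "\<lambda>_. 1" by (simp add: fequiv_refl)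

lift_definition plus_fadele :: "fadele \<Rightarrow> fadele \<Rightarrow> fadele" is "\<lambda>x y i. x i + y i"
proof -
  fix x x' y y' assume xx: "fequiv x x'" and yy: "fequiv y y'"
  have "\<exists>k. \<forall>i\<ge>k. qcong N (x i + y i) (x' i + y' i)" if "N > 0" for N
  proof -
    from xx yy that obtain k l where "\<forall>i\<ge>k. qcong N (x i) (x' i)" "\<forall>i\<ge>l. qcong N (y i) (y' i)"
      unfolding fequiv_def by meson
    then show ?thesis by (intro exI[of _ "max k l"]) (auto intro: qcong_add)
  qed
  then show "fequiv (\<lambda>i. x i + y i) (\<lambda>i. x' i + y' i)"
    using xx yy by (auto simp: fequiv_def intro: fcauchy_add)
qed

lift_definition uminus_fadele :: "fadele \<Rightarrow> fadele" is "\<lambda>x i. - x i"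
  unfolding fequiv_def by (intro conjI; (elim conjE)?; (erule fcauchy_minus)?; meson qcong_minus)

definition minus_fadele :: "fadele \<Rightarrow> fadele \<Rightarrow> fadele"
  where "minus_fadele x y = x + (- y)"

lift_definition times_fadele :: "fadele \<Rightarrow> fadele \<Rightarrow> fadele" is "\<lambda>x y i. x i * y i"
proof -
  fix x x' y y' assume xx: "fequiv x x'" and yy: "fequiv y y'"
  have "\<exists>k. \<forall>i\<ge>k. qcong N (x i * y i) (x' i * y' i)" if N: "N > 0" for N
  proof -
    from xx yy have "fcauchy x'" "fcauchy y" by (auto simp: fequiv_def)
    from fcauchy_denom2[OF this] obtain d m where d: "d > 0"
      "\<And>i. i \<ge> m \<Longrightarrow> (\<exists>u::int. of_nat d * x' i = of_int u) \<and> (\<exists>v::int. of_nat d * y i = of_int v)"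
      by blast
    have Nd: "N * d > 0" using N d by simp
    from xx yy Nd obtain k l where k: "\<And>i. i \<ge> k \<Longrightarrow> qcong (N * d) (x i) (x' i)"
      and l: "\<And>i. i \<ge> l \<Longrightarrow> qcong (N * d) (y i) (y' i)"
      unfolding fequiv_def by metis
    show ?thesis
    proof (intro exI[of _ "max m (max k l)"] allI impI)
      fix i assume i: "max m (max k l) \<le> i"
      from i d(2)[of i] obtain u v :: int
        where "of_nat d * y i = of_int u" "of_nat d * x' i = of_int v" by auto
      then show "qcong N (x i * y i) (x' i * y' i)"
        using i k l by (intro qcong_mult[of N d]) auto
    qed
  qed
  then show "fequiv (\<lambda>i. x i * y i) (\<lambda>i. x' i * y' i)"
    using xx yy by (auto simp: fequiv_def intro: fcauchy_mult)
qed

instance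
proof
  fix a b c :: fadele
  show "a * b * c = a * (b * c)"
    by transfer (simp add: fequiv_def fcauchy_mult mult.assoc)
  show "a * b = b * a"
    by transfer (simp add: fequiv_def fcauchy_mult mult.commute)
  show "1 * a = a"
    by transfer (simp add: fequiv_def)
  show "a + b + c = a + (b + c)"
    by transfer (simp add: fequiv_def fcauchy_add add.assoc)
  show "a + b = b + a"
    by transfer (simp add: fequiv_def fcauchy_add add.commute)
  show "0 + a = a"
    by transfer (simp add: fequiv_def)
  show "- a + a = 0"
    by transfer (simp add: fequiv_def)
  show "a - b = a + - b"
    by (simp add: minus_fadele_def)
  show "(a + b) * c = a * c + b * c"
    by transfer (simp add: fequiv_def fcauchy_mult fcauchy_add distrib_right)
  show "(0::fadele) \<noteq> 1"
  proof transfer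
    have "\<not> qcong 2 0 1"
    proof
      assume "qcong 2 0 1"
      then obtain z :: int where "(0::rat) - 1 = 2 * of_int z" by (auto simp: qcong_def)
      then have "of_int (2 * z) = (of_int (- 1) :: rat)" by simp
      then have "2 * z = - 1" by (simp only: of_int_eq_iff)
      then show False by presburger
    qed
    then show "\<not> fequiv (\<lambda>_. 0) (\<lambda>_. 1)"
      unfolding fequiv_def by (metis order_refl zero_less_numeral)
  qed
qed

end

lift_definition fadele_of_rat :: "rat \<Rightarrow> fadele" is "\<lambda>c _. c"
  by (simp add: fequiv_refl)

text \<open>The profinite integers, i.e.\ the closure of \<int> in the finite adeles.\<close>

definition Zhat :: "fadele set"
  where "Zhat = {abs_fadele (\<lambda>i. of_int (s i)) |s. fcauchy (\<lambda>i. of_int (s i))}"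


section \<open>Symplectic groups\<close>

definition map_mat :: "('a \<Rightarrow> 'b) \<Rightarrow> 'a^'n^'m \<Rightarrow> 'b^'n^'m"
  where "map_mat f A = (\<chi> i j. f (A $ i $ j))"

definition block :: "('a::zero)^2^2 \<Rightarrow> 'a^2^2 \<Rightarrow> 'a^2^2 \<Rightarrow> 'a^2^2 \<Rightarrow> 'a^4^4"
  where "block A B C D = vector
    [vector [A$1$1, A$1$2, B$1$1, B$1$2],
     vector [A$2$1, A$2$2, B$2$1, B$2$2],
     vector [C$1$1, C$1$2, D$1$1, D$1$2],
     vector [C$2$1, C$2$2, D$2$1, D$2$2]]"

definition Jmat :: "('a::comm_ring_1)^4^4"
  where "Jmat = block 0 (mat 1) (- mat 1) 0"

definition Sp4 :: "(('a::comm_ring_1)^4^4) set"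
  where "Sp4 = {g. transpose g ** Jmat ** g = Jmat}"

definition GSp4 :: "(('a::comm_ring_1)^4^4) set"
  where "GSp4 = {g. \<exists>m. m dvd 1 \<and> transpose g ** Jmat ** g = mat m ** Jmat}"

definition multiplier :: "real^4^4 \<Rightarrow> real"
  where "multiplier g = (THE m. transpose g ** Jmat ** g = mat m ** Jmat)"

definition GSp4_pos :: "(real^4^4) set"
  where "GSp4_pos = {g \<in> GSp4. multiplier g > 0}"

definition Sp4_int :: "(real^4^4) set"
  where "Sp4_int = map_mat of_int ` Sp4"

definition Gamma0 :: "nat \<Rightarrow> (real^4^4) set"
  where "Gamma0 q = {map_mat of_int g |g. g \<in> Sp4 \<and> (\<forall>i\<in>{3,4}. \<forall>j\<in>{1,2}. int q dvd g $ i $ j)}"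

definition Kgrp :: "(real^4^4) set"
  where "Kgrp = {k. orthogonal_matrix k \<and> det k = 1} \<inter> Sp4"

definition umat :: "real \<Rightarrow> real \<Rightarrow> real \<Rightarrow> real \<Rightarrow> real^4^4"
  where "umat x12 x13 x23 x24 = vector
    [vector [1, x12, x13, x23 + x12 * x24],
     vector [0, 1, x23, x24],
     vector [0, 0, 1, 0],
     vector [0, 0, - x12, 1]]"

definition Ugrp :: "(real^4^4) set"
  where "Ugrp = {umat x12 x13 x23 x24 |x12 x13 x23 x24. True}"

definition iota :: "real \<Rightarrow> real \<Rightarrow> real^4^4"
  where "iota y1 y2 = vector
    [vector [y1 * sqrt y2, 0, 0, 0],
     vector [0, sqrt y2, 0, 0],
     vector [0, 0, 1 / (y1 * sqrt y2), 0],
     vector [0, 0, 0, 1 / sqrt y2]]"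

definition theta :: "nat \<Rightarrow> nat \<Rightarrow> real^4^4 \<Rightarrow> complex"
  where "theta M1 M2 x = cis (2 * pi * (real M1 * x $ 1 $ 2 + real M2 * x $ 2 $ 4))"


section \<open>Invariant differential operators and spectral parameters\<close>

definition mexp :: "real^4^4 \<Rightarrow> real^4^4"
  where "mexp X = (\<Sum>n. (1 / fact n) *\<^sub>R (((**) X) ^^ n) (mat 1))"

definition gsp4_alg :: "(real^4^4) set"
  where "gsp4_alg = {X. \<exists>c. transpose X ** Jmat + Jmat ** X = mat c ** Jmat}"

definition sp4_alg :: "(real^4^4) set"
  where "sp4_alg = {X. transpose X ** Jmat + Jmat ** X = 0}"

definition lie_deriv :: "real^4^4 \<Rightarrow> (real^4^4 \<Rightarrow> complex) \<Rightarrow> real^4^4 \<Rightarrow> complex"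
  where "lie_deriv X f g = vector_derivative (\<lambda>t. f (g ** mexp (t *\<^sub>R X))) (at 0)"

text \<open>
  Below, \<open>G\<close> is a matrix Lie group with Lie algebra \<open>L\<close>.  A function on \<open>G\<close> is smooth iff all
  its iterated derivatives along left-invariant vector fields exist and are continuous.
\<close>

definition smooth_fun :: "(real^4^4) set \<Rightarrow> (real^4^4) set \<Rightarrow> (real^4^4 \<Rightarrow> complex) \<Rightarrow> bool"
  where "smooth_fun G L f \<longleftrightarrow> (\<forall>Xs \<in> lists L. let h = foldr lie_deriv Xs f in
    continuous_on G h \<and>
    (\<forall>X\<in>L. \<forall>g\<in>G. (\<lambda>t. h (g ** mexp (t *\<^sub>R X))) differentiable (at 0)))"

text \<open>The universal enveloping algebra (complexified), as left-invariant differential operators.\<close>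

inductive_set env_alg :: "(real^4^4) set \<Rightarrow> ((real^4^4 \<Rightarrow> complex) \<Rightarrow> real^4^4 \<Rightarrow> complex) set"
  for L :: "(real^4^4) set" where
  one: "(\<lambda>f. f) \<in> env_alg L"
| deriv: "D \<in> env_alg L \<Longrightarrow> X \<in> L \<Longrightarrow> (\<lambda>f. lie_deriv X (D f)) \<in> env_alg L"
| add: "D \<in> env_alg L \<Longrightarrow> E \<in> env_alg L \<Longrightarrow> (\<lambda>f g. D f g + E f g) \<in> env_alg L"
| scale: "D \<in> env_alg L \<Longrightarrow> (\<lambda>f g. c * D f g) \<in> env_alg L"

definition env_center ::
  "(real^4^4) set \<Rightarrow> (real^4^4) set \<Rightarrow> ((real^4^4 \<Rightarrow> complex) \<Rightarrow> real^4^4 \<Rightarrow> complex) set"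
  where "env_center G L = {D \<in> env_alg L. \<forall>X\<in>L. \<forall>f. smooth_fun G L f \<longrightarrow>
    (\<forall>g\<in>G. D (lie_deriv X f) g = lie_deriv X (D f) g)}"

text \<open>
  The spherical principal series vector \<open>x \<iota>(y) k \<mapsto> y\<^sup>\<eta>\<^sup>+\<^sup>\<mu>\<close>.  In the coordinates \<open>y\<close> the half
  sum of the positive roots is \<open>\<eta> = (2, 3/2)\<close>.
\<close>

definition Ifun :: "complex \<times> complex \<Rightarrow> real^4^4 \<Rightarrow> complex"
  where "Ifun \<mu> g = (THE c. \<exists>x\<in>Ugrp. \<exists>y1>0. \<exists>y2>0. \<exists>k\<in>Kgrp. g = x ** iota y1 y2 ** k \<and>
    c = complex_of_real y1 powr (2 + fst \<mu>) * complex_of_real y2 powr (3/2 + snd \<mu>))"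

text \<open>
  \<open>\<mu>\<close> is the spectral parameter of \<open>f\<close> if every central \<open>D\<close> acts on \<open>f\<close> by the scalar by which it
  acts on \<open>Ifun \<mu>\<close>; this scalar is \<open>(D (Ifun \<mu>)) (1)\<close> because \<open>Ifun \<mu> (1) = 1\<close>.
\<close>

definition spectral_parameter :: "complex \<times> complex \<Rightarrow> (real^4^4 \<Rightarrow> complex) \<Rightarrow> bool"
  where "spectral_parameter \<mu> f \<longleftrightarrow>
    (\<forall>D \<in> env_center Sp4 sp4_alg. \<forall>g\<in>Sp4. D f g = D (Ifun \<mu>) (mat 1) * f g)"

text \<open>On \<open>Sp4\<close> the norm of \<open>matrix_inv g\<close> equals that of \<open>g\<close>; it matters on \<open>GSp4\<close> only.\<close>

definition moderate_growth :: "(real^4^4) set \<Rightarrow> (real^4^4 \<Rightarrow> complex) \<Rightarrow> bool"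
  where "moderate_growth G f \<longleftrightarrow>
    (\<exists>C n. \<forall>g\<in>G. norm (f g) \<le> C * (norm g + norm (matrix_inv g)) ^ n)"


section \<open>Cusp forms on the symplectic group\<close>

text \<open>Unipotent radicals of the Siegel and Klingen parabolics, the two standard maximal ones.\<close>

definition siegel_rad :: "real \<times> real \<times> real \<Rightarrow> real^4^4"
  where "siegel_rad = (\<lambda>(a, b, c). umat 0 a b c)"

definition klingen_rad :: "real \<times> real \<times> real \<Rightarrow> real^4^4"
  where "klingen_rad = (\<lambda>(a, b, c). umat a b c 0)"

text \<open>
  Cuspidality at all rational parabolics: these are the \<open>Sp4_int\<close>-conjugates of the standard ones.
  As \<open>Gamma0 N\<close> contains the principal congruence subgroup of level \<open>N\<close>, the function
  \<open>n \<mapsto> \<phi> (\<gamma> n g)\<close> is invariant under the \<open>n\<close> congruent to 1 modulo \<open>N\<close>, for which the box of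
  side \<open>N\<close> is a fundamental domain.
\<close>

definition cusp_form :: "nat \<Rightarrow> complex \<times> complex \<Rightarrow> (real^4^4 \<Rightarrow> complex) \<Rightarrow> bool"
  where "cusp_form N \<mu> \<phi> \<longleftrightarrow> N > 0 \<and>
    (\<forall>\<gamma>\<in>Gamma0 N. \<forall>g\<in>Sp4. \<forall>k\<in>Kgrp. \<phi> (\<gamma> ** g ** k) = \<phi> g) \<and>
    smooth_fun Sp4 sp4_alg \<phi> \<and> spectral_parameter \<mu> \<phi> \<and> moderate_growth Sp4 \<phi> \<and>
    (\<forall>n\<in>{siegel_rad, klingen_rad}. \<forall>\<gamma>\<in>Sp4_int. \<forall>g\<in>Sp4.
      integral (cbox (0, 0, 0) (real N, real N, real N)) (\<lambda>t. \<phi> (\<gamma> ** n t ** g)) = 0)"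

definition newform :: "nat \<Rightarrow> complex \<times> complex \<Rightarrow> (real^4^4 \<Rightarrow> complex) \<Rightarrow> bool"
  where "newform q \<mu> \<phi> \<longleftrightarrow> (\<exists>N. N dvd q \<and> cusp_form N \<mu> \<phi>)"

text \<open>Extension from \<open>Sp4\<close> to \<open>GSp4_pos\<close>, invariant under the centre.\<close>

definition ext :: "(real^4^4 \<Rightarrow> complex) \<Rightarrow> real^4^4 \<Rightarrow> complex"
  where "ext \<phi> g = \<phi> ((1 / sqrt (multiplier g)) *\<^sub>R g)"


section \<open>Cuspidal automorphic representations of GSp(4) with trivial central character\<close>

text \<open>
  Functions on \<open>GSp4(\<real>) \<times> GSp4(A\<^sub>f)\<close> are represented by total functions vanishing elsewhere.
\<close>

type_synonym aform = "real^4^4 \<Rightarrow> fadele^4^4 \<Rightarrow> complex"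

definition GSp4_Zhat :: "(fadele^4^4) set"
  where "GSp4_Zhat = {k. (\<forall>i j. k $ i $ j \<in> Zhat) \<and>
    (\<exists>m\<in>Zhat. \<exists>m'\<in>Zhat. m * m' = 1 \<and> transpose k ** Jmat ** k = mat m ** Jmat)}"

definition K_princ :: "nat \<Rightarrow> (fadele^4^4) set"
  where "K_princ N = {k \<in> GSp4_Zhat. \<forall>i j. \<exists>z\<in>Zhat. k $ i $ j - mat 1 $ i $ j = of_nat N * z}"

definition K0 :: "nat \<Rightarrow> (fadele^4^4) set"
  where "K0 N = {k \<in> GSp4_Zhat. \<forall>i\<in>{3,4}. \<forall>j\<in>{1,2}. \<exists>z\<in>Zhat. k $ i $ j = of_nat N * z}"

definition K_max :: "(real^4^4) set"
  where "K_max = {k. orthogonal_matrix k} \<inter> GSp4"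

definition acspan :: "aform set \<Rightarrow> aform set"
  where "acspan F = {\<psi>. \<exists>c. \<forall>g h. \<psi> g h = (\<Sum>f\<in>F. c f * f g h)}"

text \<open>
  In the last clause \<open>N(\<rat>)\<backslash>N(A)\<close> is rewritten by strong approximation for the unipotent
  radical \<open>N\<close>: for \<open>h\<close> fixed the integrand is invariant under \<open>N(M\<int>)\<close> for a suitable \<open>M\<close>, and the
  adelic integral is a positive multiple of the integral over \<open>N(M\<int>)\<backslash>N(\<real>)\<close>.
\<close>

definition cuspidal_automorphic_form :: "aform \<Rightarrow> bool"
  where "cuspidal_automorphic_form \<phi> \<longleftrightarrow>
    (\<forall>g h. \<not> (g \<in> GSp4 \<and> h \<in> GSp4) \<longrightarrow> \<phi> g h = 0) \<and>
    (\<forall>\<gamma>\<in>GSp4. \<forall>g\<in>GSp4. \<forall>h\<in>GSp4.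
      \<phi> (map_mat of_rat \<gamma> ** g) (map_mat fadele_of_rat \<gamma> ** h) = \<phi> g h) \<and>
    (\<forall>z w. z \<noteq> 0 \<longrightarrow> w dvd 1 \<longrightarrow> (\<forall>g\<in>GSp4. \<forall>h\<in>GSp4. \<phi> (mat z ** g) (mat w ** h) = \<phi> g h)) \<and>
    (\<exists>N>0. \<forall>k\<in>K_princ N. \<forall>g\<in>GSp4. \<forall>h\<in>GSp4. \<phi> g (h ** k) = \<phi> g h) \<and>
    (\<forall>h\<in>GSp4. smooth_fun GSp4 gsp4_alg (\<lambda>g. \<phi> g h) \<and> moderate_growth GSp4 (\<lambda>g. \<phi> g h)) \<and>
    (\<exists>F. finite F \<and> (\<forall>k\<in>K_max. (\<lambda>g h. \<phi> (g ** k) h) \<in> acspan F)) \<and>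
    (\<exists>F. finite F \<and>
      (\<forall>D \<in> env_center GSp4 gsp4_alg. (\<lambda>g h. D (\<lambda>x. \<phi> x h) g) \<in> acspan F)) \<and>
    (\<forall>n\<in>{siegel_rad, klingen_rad}. \<forall>h\<in>GSp4. \<forall>M::nat. M > 0 \<longrightarrow>
      (\<forall>a b c :: int. \<forall>g\<in>GSp4.
        \<phi> (n (real M * of_int a, real M * of_int b, real M * of_int c) ** g) h = \<phi> g h) \<longrightarrow>
      (\<forall>g\<in>GSp4. integral (cbox (0, 0, 0) (real M, real M, real M)) (\<lambda>t. \<phi> (n t ** g) h) = 0))"

text \<open>Complex subspaces stable under \<open>GSp4(A\<^sub>f)\<close>, the Lie algebra and the maximal compact group.\<close>

definition invariant_subspace :: "aform set \<Rightarrow> bool"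
  where "invariant_subspace V \<longleftrightarrow>
    (\<lambda>g h. 0) \<in> V \<and>
    (\<forall>\<phi>\<in>V. \<forall>\<psi>\<in>V. (\<lambda>g h. \<phi> g h + \<psi> g h) \<in> V) \<and>
    (\<forall>\<phi>\<in>V. \<forall>c. (\<lambda>g h. c * \<phi> g h) \<in> V) \<and>
    (\<forall>\<phi>\<in>V. \<forall>k\<in>GSp4. (\<lambda>g h. \<phi> g (h ** k)) \<in> V) \<and>
    (\<forall>\<phi>\<in>V. \<forall>k\<in>K_max. (\<lambda>g h. \<phi> (g ** k) h) \<in> V) \<and>
    (\<forall>\<phi>\<in>V. \<forall>X\<in>gsp4_alg. (\<lambda>g h. lie_deriv X (\<lambda>x. \<phi> x h) g) \<in> V)"

definition irreducible_cuspidal_rep :: "aform set \<Rightarrow> bool"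
  where "irreducible_cuspidal_rep V \<longleftrightarrow>
    (\<forall>\<phi>\<in>V. cuspidal_automorphic_form \<phi>) \<and> invariant_subspace V \<and> V \<noteq> {\<lambda>g h. 0} \<and>
    (\<forall>W \<subseteq> V. invariant_subspace W \<longrightarrow> W = {\<lambda>g h. 0} \<or> W = V)"

text \<open>
  A form \<open>f\<close> on \<open>Gamma0 q\<close> is viewed as the automorphic form \<open>\<gamma> g k \<mapsto> ext f g\<close>
  (\<open>\<gamma> \<in> GSp4(\<rat>)\<close>, \<open>g \<in> GSp4_pos\<close>, \<open>k \<in> K0 q\<close>); \<open>in_rep q f V\<close> says that it lies in \<open>V\<close>.
\<close>

definition in_rep :: "nat \<Rightarrow> (real^4^4 \<Rightarrow> complex) \<Rightarrow> aform set \<Rightarrow> bool"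
  where "in_rep q f V \<longleftrightarrow> (\<exists>\<phi>\<in>V.
    (\<forall>g\<in>GSp4. \<forall>h\<in>GSp4. \<forall>k\<in>K0 q. \<phi> g (h ** k) = \<phi> g h) \<and>
    (\<forall>g\<in>GSp4_pos. \<phi> g (mat 1) = ext f g))"


section \<open>Whittaker functions, Fourier coefficients and Hecke operators\<close>

definition spherical_whittaker :: "complex \<times> complex \<Rightarrow> (real^4^4 \<Rightarrow> complex) \<Rightarrow> bool"
  where "spherical_whittaker \<mu> W \<longleftrightarrow>
    (\<forall>x\<in>Ugrp. \<forall>g\<in>Sp4. \<forall>k\<in>Kgrp. W (x ** g ** k) = theta 1 1 x * W g) \<and>
    smooth_fun Sp4 sp4_alg W \<and> spectral_parameter \<mu> W \<and> moderate_growth Sp4 W \<and>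
    (\<exists>g\<in>Sp4. W g \<noteq> 0)"

text \<open>The unit cube in the coordinates of \<open>umat\<close> is a fundamental domain for \<open>U(\<int>)\<backslash>U(\<real>)\<close>.\<close>

definition U_integral :: "(real^4^4 \<Rightarrow> complex) \<Rightarrow> complex"
  where "U_integral F = integral (cbox (0, 0, 0, 0) (1, 1, 1, 1))
    (\<lambda>(x12, x13, x23, x24). F (umat x12 x13 x23 x24))"

definition fourier_coefficients ::
  "(real^4^4 \<Rightarrow> complex) \<Rightarrow> (real^4^4 \<Rightarrow> complex) \<Rightarrow> (nat \<Rightarrow> nat \<Rightarrow> complex) \<Rightarrow> bool"
  where "fourier_coefficients W \<phi> A \<longleftrightarrow>
    (\<forall>M1>0. \<forall>M2>0. \<forall>x\<in>Ugrp. \<forall>y1>0. \<forall>y2>0. \<forall>k\<in>Kgrp.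
      U_integral (\<lambda>u. \<phi> (u ** (x ** iota y1 y2 ** k)) * cnj (theta M1 M2 u)) =
      A M1 M2 / complex_of_real (real M1 ^ 2 * real M2 powr (3/2)) * theta M1 M2 x *
        W (iota (real M1) (real M2) ** iota y1 y2))"

definition Smat :: "nat \<Rightarrow> (int^4^4) set"
  where "Smat m = {M. transpose M ** Jmat ** M = mat (int m) ** Jmat}"

text \<open>Representatives of \<open>Sp4(\<int>)\<backslash>Smat m\<close>; \<open>C\<close> is the integral matrix \<open>m\<^sup>-\<^sup>1BD\<close>.\<close>

definition Hset :: "nat \<Rightarrow> (int^4^4) set"
  where "Hset m = {h \<in> Smat m. \<exists>a1 a2 a b1 b2 b3. \<exists>A B C D :: int^2^2.
    A = vector [vector [a1, a], vector [0, a2]] \<and>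
    B = vector [vector [b1, b2], vector [b2, b3]] \<and>
    a1 > 0 \<and> a2 > 0 \<and> 0 \<le> a \<and> a < a2 \<and> {b1, b2, b3} \<subseteq> {0..<int m} \<and>
    A ** transpose D = mat (int m) \<and> B ** D = mat (int m) ** C \<and> h = block A C 0 D}"

definition hecke_op :: "nat \<Rightarrow> (real^4^4 \<Rightarrow> complex) \<Rightarrow> real^4^4 \<Rightarrow> complex"
  where "hecke_op m \<phi> g = (\<Sum>h\<in>Hset m. ext \<phi> (map_mat of_int h ** g))"

definition hecke_eigenvalue :: "nat \<Rightarrow> (real^4^4 \<Rightarrow> complex) \<Rightarrow> complex \<Rightarrow> bool"
  where "hecke_eigenvalue m \<phi> l \<longleftrightarrow> (\<forall>g\<in>Sp4. hecke_op m \<phi> g = l * \<phi> g)"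

end

theory Submission
  imports Defs
begin

text \<open>
  Write \<open>e(t)\<close> for \<open>exp(2\<pi>it)\<close>.  Integrate the eigenvalue equation \<open>T(m)\<phi> = \<lambda>(m)\<phi>\<close> at \<open>u \<iota>(y)\<close> against the
  conjugate of \<open>\<theta>(u)\<close> over \<open>U(\<int>)\<backslash>U(\<real>)\<close>.  As \<open>A(1,1) = 1\<close>, one side is \<open>\<lambda>(m) W(\<iota>(y))\<close>.  On the other
  side a representative \<open>h\<close> with parameters \<open>a\<^sub>1, a\<^sub>2, a, b\<^sub>1, b\<^sub>2, b\<^sub>3\<close> is a rational unipotent matrix times
  \<open>t = diag(a\<^sub>1, a\<^sub>2, m/a\<^sub>1, m/a\<^sub>2)\<close>.  Conjugation by \<open>t\<close> turns \<open>\<theta>\<close> into the character with frequencies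
  \<open>M\<^sub>1 = a\<^sub>2/a\<^sub>1\<close> and \<open>M\<^sub>2 = m/a\<^sub>2\<^sup>2\<close>, and \<open>t/\<surd>m = \<iota>(1/M\<^sub>1, 1/M\<^sub>2)\<close>.  So \<open>h\<close> contributes nothing unless both
  frequencies are integers, and otherwise it contributes
  \<open>e(a/a\<^sub>1 + b\<^sub>3/a\<^sub>2\<^sup>2) A(M\<^sub>1,M\<^sub>2) M\<^sub>1\<^sup>-\<^sup>2 M\<^sub>2\<^sup>-\<^sup>3\<^sup>/\<^sup>2 W(\<iota>(y))\<close>: the Whittaker value is the same for all \<open>h\<close> and cancels,
  because it is nonzero for some \<open>y\<close> by the Iwasawa decomposition (\<open>iwasawa\<close>).  This gives
  \<open>hecke_eigenvalue_sum\<close>.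

  The single terms \<open>u \<mapsto> \<phi>(h u \<iota>(y))\<close> are invariant only under a subgroup of \<open>U(\<int>)\<close> that depends on \<open>h\<close>.  The
  unfolding of the sum over \<open>h\<close> that this calls for is avoided as follows.  The sum over \<open>h\<close> equals \<open>\<lambda>(m)\<phi>\<close>,
  which is \<open>U(\<int>)\<close>-invariant, so the unit cube may be replaced by the cube of side \<open>m\<close>; over that cube every
  term runs through whole periods in each coordinate, and it can be integrated alone (\<open>twisted_box_coef\<close>,
  \<open>twisted_box_0\<close>).

  It remains to add the phases.  For fixed \<open>a\<^sub>1 | a\<^sub>2\<close> with \<open>a\<^sub>2\<^sup>2 | m\<close> the congruences on the representatives leave
  \<open>b\<^sub>3/a\<^sub>2\<close> free among the multiples of \<open>a\<^sub>1/gcd(a\<^sub>1,a)\<close>.  The sum of \<open>e(b\<^sub>3/a\<^sub>2\<^sup>2)\<close> over these is a complete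
  exponential sum, which vanishes unless \<open>a\<^sub>1 = a\<^sub>2 = n\<close> and \<open>a\<close> is prime to \<open>n\<close>; the sum over \<open>a\<close> is then the
  Ramanujan sum \<open>c\<^sub>n(1) = \<mu>(n)\<close>.  Hence (\<open>sum_hecke_weight\<close>)
  \<open>\<lambda>(m) = \<Sum> \<mu>(n) n\<^sup>2 (m/n\<^sup>2)\<^sup>3\<^sup>/\<^sup>2 A(1, m/n\<^sup>2)\<close> over the \<open>n\<close> with \<open>n\<^sup>2 | m\<close>.
  For \<open>m = p\<^sup>r\<close> only \<open>n = 1\<close> and, when \<open>r \<ge> 2\<close>, \<open>n = p\<close> survive.
\<close>

section \<open>Integrals of periodic functions along affine lines\<close>

definition ee :: "real \<Rightarrow> complex" where "ee t = cis (2 * pi * t)"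

lemma ee_add: "ee (s + t) = ee s * ee t"
  by (simp add: ee_def cis_mult distrib_left)

lemma ee_of_int [simp]: "ee (of_int n) = 1"
  by (simp add: ee_def cis_multiple_2pi)

lemma ee_0 [simp]: "ee 0 = 1"
  by (simp add: ee_def)

lemma cnj_ee: "cnj (ee t) = ee (- t)"
  by (simp add: ee_def cis_cnj)

lemma ee_power: "ee t ^ n = ee (real n * t)"
  by (simp add: ee_def Complex.DeMoivre mult_ac)

lemma ee_eq_1_iff: "ee t = 1 \<longleftrightarrow> t \<in> \<int>"
proof
  assume "ee t = 1"
  then have "cos (2 * pi * t) = 1" by (metis ee_def cis.sel(1) one_complex.sel(1))
  then obtain n :: int where "2 * pi * t = of_int n * (2 * pi)"
    by (auto simp: cos_one_2pi_int)
  then have "t = of_int n" by simp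
  then show "t \<in> \<int>" by simp
qed (auto elim: Ints_cases)

lemma continuous_ee [continuous_intros]:
  "continuous_on A f \<Longrightarrow> continuous_on A (\<lambda>x. ee (f x))"
  unfolding ee_def by (intro continuous_intros)

lemma integral_over_period:
  fixes g :: "real \<Rightarrow> complex"
  assumes g: "continuous_on UNIV g" and per: "\<And>x. g (x + L) = g x" and L: "L > 0"
  shows "integral {c..c+L} g = integral {0..L} g"
proof -
  have gi: "g integrable_on {a..b}" for a b
    by (rule integrable_continuous_real[OF continuous_on_subset[OF g]]) simp
  have per_nat: "g (x + real n * L) = g x" for x n
  proof (induction n)
    case (Suc n)
    have "x + real (Suc n) * L = (x + real n * L) + L" by (simp add: algebra_simps)
    then show ?case using per[of "x + real n * L"] Suc by (simp only:)
  qed simp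
  have per_int: "g (x + of_int k * L) = g x" for x k
  proof (cases "k \<ge> 0")
    case True
    then show ?thesis using per_nat[of x "nat k"] by simp
  next
    case False
    then show ?thesis using per_nat[of "x + of_int k * L" "nat (-k)"] by simp
  qed
  define k where "k = \<lfloor>c / L\<rfloor>"
  define d where "d = c - of_int k * L"
  have d: "0 \<le> d" "d \<le> L"
    using L floor_divide_lower[OF L, of c] floor_divide_upper[OF L, of c]
    by (auto simp: d_def k_def algebra_simps)
  have sh: "integral {a+t..b+t} g = integral {a..b} (\<lambda>x. g (x + t))" for a b t
    using integral_shift_real_ivl[of "a+t" t "b+t" g] by simp
  have "integral {c..c+L} g = integral {d + of_int k * L..(d+L) + of_int k * L} g"
    by (simp add: d_def)
  also have "\<dots> = integral {d..d+L} g" by (subst sh) (simp add: per_int)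
  also have "\<dots> = integral {d..L} g + integral {0 + L..d+L} g"
    using d Henstock_Kurzweil_Integration.integral_combine[OF _ _ gi, of d L "d+L"] by simp
  also have "integral {0+L..d+L} g = integral {0..d} g" by (subst sh) (simp add: per)
  also have "integral {d..L} g + integral {0..d} g = integral {0..L} g"
    using d Henstock_Kurzweil_Integration.integral_combine[OF _ _ gi, of 0 d L] by (simp add: add.commute)
  finally show ?thesis .
qed

lemma integral_over_periods:
  fixes g :: "real \<Rightarrow> complex"
  assumes g: "continuous_on UNIV g" and per: "\<And>x. g (x + 1) = g x"
  shows "integral {c..c + real N} g = of_nat N * integral {0..1} g"
proof (induction N)
  case (Suc N)
  have gi: "g integrable_on {a..b}" for a b
    by (rule integrable_continuous_real[OF continuous_on_subset[OF g]]) simp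
  have "integral {c..c + real (Suc N)} g
      = integral {c..c + real N} g + integral {c + real N..(c + real N) + 1} g"
    using Henstock_Kurzweil_Integration.integral_combine[OF _ _ gi, of c "c + real N" "c + real (Suc N)"]
    by (simp add: add_ac)
  then show ?case using Suc integral_over_period[OF g per, of "c + real N"] by (simp add: algebra_simps)
qed simp

text \<open>
  The hypothesis on \<open>\<alpha> * L\<close> says that the affine line sweeps out a whole number of periods, so that its
  offset and its slope do not matter.
\<close>

lemma integral_affine_periodic:
  fixes g :: "real \<Rightarrow> complex"
  assumes g: "continuous_on UNIV g" and per: "\<And>x. g (x + 1) = g x"
    and \<alpha>: "\<alpha> > 0" and L: "\<alpha> * L = real N"
  shows "integral {0..L} (\<lambda>s. g (\<beta> + \<alpha> * s)) = of_real L * integral {0..1} g"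
proof -
  have gi: "g integrable_on cbox \<beta> (\<beta> + real N)"
    by (rule integrable_continuous[OF continuous_on_subset[OF g]]) simp
  have "((\<lambda>s. g (\<alpha> *\<^sub>R s + \<beta>)) has_integral (integral (cbox \<beta> (\<beta> + real N)) g /\<^sub>R \<alpha> ^ DIM(real)))
      (cbox ((\<beta> - \<beta>) /\<^sub>R \<alpha>) ((\<beta> + real N - \<beta>) /\<^sub>R \<alpha>))"
    by (rule has_integral_affinity'[OF integrable_integral[OF gi] \<alpha>])
  moreover have "(\<beta> + real N - \<beta>) /\<^sub>R \<alpha> = L" using \<alpha> L[symmetric] by simp
  ultimately have "integral {0..L} (\<lambda>s. g (\<beta> + \<alpha> * s)) = integral {\<beta>..\<beta> + real N} g /\<^sub>R \<alpha>"
    by (simp add: integral_unique add.commute)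
  also have "\<dots> = (real N / \<alpha>) *\<^sub>R integral {0..1} g"
    unfolding integral_over_periods[OF g per] by (simp add: scaleR_conv_of_real field_simps)
  also have "real N / \<alpha> = L" using \<alpha> L[symmetric] by simp
  finally show ?thesis by (simp add: scaleR_conv_of_real)
qed

text \<open>
  For slope \<open>1 / M\<close> the factor \<open>ee (- s)\<close> is, up to the constant \<open>ee (M * \<beta>)\<close>, the value at the point
  \<open>v = \<beta> + \<alpha> * s\<close> of the 1-periodic function \<open>ee (- M * v)\<close>; the untwisted case applies to the product.
\<close>

lemma integral_affine_twisted:
  fixes g :: "real \<Rightarrow> complex"
  assumes g: "continuous_on UNIV g" and per: "\<And>x. g (x + 1) = g x"
    and M: "M > 0" and \<alpha>: "\<alpha> = 1 / real M" and L: "\<alpha> * L = real N"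
  shows "integral {0..L} (\<lambda>s. g (\<beta> + \<alpha> * s) * ee (- s)) =
     of_real L * (ee (real M * \<beta>) * integral {0..1} (\<lambda>v. g v * ee (- (real M * v))))"
proof -
  define h where "h = (\<lambda>v. g v * ee (- (real M * v)))"
  have h: "continuous_on UNIV h" unfolding h_def by (intro continuous_intros g)
  have hp: "h (x + 1) = h x" for x
  proof -
    have "- (real M * (x + 1)) = - (real M * x) + of_int (- int M)" by (simp add: algebra_simps)
    then show ?thesis unfolding h_def per by (metis ee_add ee_of_int mult.right_neutral)
  qed
  have "g (\<beta> + \<alpha> * s) * ee (- s) = ee (real M * \<beta>) * h (\<beta> + \<alpha> * s)" for s
  proof -
    have "- s = real M * \<beta> + - (real M * (\<beta> + \<alpha> * s))" using M by (simp add: \<alpha> field_simps)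
    then show ?thesis unfolding h_def by (metis ee_add mult.assoc mult.commute)
  qed
  then have "integral {0..L} (\<lambda>s. g (\<beta> + \<alpha> * s) * ee (- s))
     = ee (real M * \<beta>) * integral {0..L} (\<lambda>s. h (\<beta> + \<alpha> * s))" by simp
  also have "integral {0..L} (\<lambda>s. h (\<beta> + \<alpha> * s)) = of_real L * integral {0..1} h"
    by (rule integral_affine_periodic[OF h hp]) (use M L \<alpha> in auto)
  finally show ?thesis by (simp add: h_def)
qed

text \<open>
  Shifting \<open>s\<close> by \<open>1 / \<alpha>\<close> moves \<open>\<beta> + \<alpha> * s\<close> by a period and multiplies the integrand by a number other
  than 1, while the integral over a period is invariant under shifts.
\<close>

lemma integral_affine_twisted_0:
  fixes g :: "real \<Rightarrow> complex"
  assumes g: "continuous_on UNIV g" and per: "\<And>x. g (x + 1) = g x"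
    and \<alpha>: "\<alpha> > 0" "1 / \<alpha> \<notin> \<int>" and L: "\<alpha> * real L = real N" "L > 0"
  shows "integral {0..real L} (\<lambda>s. g (\<beta> + \<alpha> * s) * ee (- s)) = 0"
proof -
  define h where "h = (\<lambda>s. g (\<beta> + \<alpha> * s) * ee (- s))"
  have h: "continuous_on UNIV h" unfolding h_def
    by (intro continuous_intros continuous_on_compose2[OF g]) auto
  have pern: "g (x + real n) = g x" for x n
  proof (induction n)
    case (Suc n)
    then show ?case using per[of "x + real n"] by (simp add: add_ac)
  qed simp
  have hp: "h (s + real L) = h s" for s
  proof -
    have "\<beta> + \<alpha> * (s + real L) = (\<beta> + \<alpha> * s) + real N" using L by (simp add: algebra_simps)
    moreover have "- (s + real L) = - s + of_int (- int L)" by simp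
    then have "ee (- (s + real L)) = ee (- s)" by (metis ee_add ee_of_int mult.right_neutral)
    ultimately show ?thesis unfolding h_def by (simp only: pern)
  qed
  have hs: "h (s + 1 / \<alpha>) = h s * ee (- (1 / \<alpha>))" for s
  proof -
    have "\<beta> + \<alpha> * (s + 1 / \<alpha>) = (\<beta> + \<alpha> * s) + 1" using \<alpha> by (simp add: field_simps)
    moreover have "- (s + 1 / \<alpha>) = - s + - (1 / \<alpha>)" by simp
    ultimately show ?thesis unfolding h_def by (simp only: per ee_add mult.assoc)
  qed
  have "integral {0..real L} h = integral {1/\<alpha>..1/\<alpha> + real L} h"
    using integral_over_period[OF h hp] L by simp
  also have "\<dots> = integral {0..real L} (\<lambda>s. h (s + 1 / \<alpha>))"
    using integral_shift_real_ivl[of "1/\<alpha>" "1/\<alpha>" "1/\<alpha> + real L" h] by simp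
  also have "\<dots> = integral {0..real L} h * ee (- (1 / \<alpha>))" unfolding hs by simp
  finally have "integral {0..real L} h = 0 \<or> ee (- (1/\<alpha>)) = 1" by simp
  moreover have "- (1/\<alpha>) \<notin> \<int>" using \<alpha> by (metis Ints_minus minus_minus)
  ultimately show ?thesis by (auto simp: h_def ee_eq_1_iff)
qed

section \<open>Periodic functions on the unipotent group\<close>

lemma continuous_on_integral_last:
  fixes f :: "'a::topological_space \<times> real \<Rightarrow> complex"
  assumes "continuous_on UNIV f"
  shows "continuous_on UNIV (\<lambda>p. integral {a..b} (\<lambda>t. f (p, t)))"
proof -
  have "continuous_on (UNIV \<times> cbox a b) (\<lambda>(p, t). f (p, t))"
    using continuous_on_subset[OF assms] by simp
  from integral_continuous_on_param[OF this] show ?thesis by simp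
qed

text \<open>
  A function on \<open>U(\<real>)\<close> in the coordinates \<open>(x, s3, s2, s1)\<close> of \<open>n(S) m(x)\<close>, where \<open>n(S)\<close> is the Siegel unipotent
  with symmetric block \<open>S\<close> (\<open>s1\<close>, \<open>s3\<close> on the diagonal, \<open>s2\<close> off it) and \<open>m(x)\<close> the unipotent of the Levi
  subgroup.  The conditions are invariance under generators of \<open>U(\<int>)\<close>; in the last one \<open>m(1)\<close> acts on \<open>S\<close>.
  The order of the coordinates is the order of integration, outermost first: \<open>s1\<close> and \<open>s2\<close>, on which
  \<open>\<theta>\<close> does not depend, are integrated out before the others.
\<close>

definition U_periodic :: "(real \<times> real \<times> real \<times> real \<Rightarrow> complex) \<Rightarrow> bool"
  where "U_periodic f \<longleftrightarrow> continuous_on UNIV f \<and>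
    (\<forall>x s3 s2 s1. f (x, s3, s2, s1 + 1) = f (x, s3, s2, s1) \<and>
       f (x, s3, s2 + 1, s1) = f (x, s3, s2, s1) \<and>
       f (x, s3 + 1, s2, s1) = f (x, s3, s2, s1) \<and>
       f (x + 1, s3, s2 + s3, s1 + 2 * s2 + s3) = f (x, s3, s2, s1))"

definition siegel_mean1 :: "(real \<times> real \<times> real \<times> real \<Rightarrow> complex) \<Rightarrow> real \<times> real \<times> real \<Rightarrow> complex"
  where "siegel_mean1 f = (\<lambda>(x, s3, s2). integral {0..1} (\<lambda>s1. f (x, s3, s2, s1)))"

definition siegel_mean :: "(real \<times> real \<times> real \<times> real \<Rightarrow> complex) \<Rightarrow> real \<times> real \<Rightarrow> complex"
  where "siegel_mean f = (\<lambda>(x, s3). integral {0..1} (\<lambda>s2. siegel_mean1 f (x, s3, s2)))"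

definition fourier_coef :: "(real \<times> real \<times> real \<times> real \<Rightarrow> complex) \<Rightarrow> nat \<Rightarrow> nat \<Rightarrow> complex"
  where "fourier_coef f M1 M2 = integral {0..1} (\<lambda>x.
     integral {0..1} (\<lambda>s3. siegel_mean f (x, s3) * ee (- (real M2 * s3))) * ee (- (real M1 * x)))"

context
  fixes f assumes f: "U_periodic f"
begin

lemma U_periodic_cont: "continuous_on UNIV f"
  using f by (simp add: U_periodic_def)

lemma U_periodic_cont':
  "continuous_on A a \<Longrightarrow> continuous_on A b \<Longrightarrow> continuous_on A c \<Longrightarrow> continuous_on A d \<Longrightarrow>
   continuous_on A (\<lambda>t. f (a t, b t, c t, d t))"
  by (rule continuous_on_compose2[OF U_periodic_cont]) (auto intro!: continuous_intros)

lemma siegel_mean1_cont: "continuous_on UNIV (siegel_mean1 f)"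
proof -
  have "continuous_on UNIV (\<lambda>(p::real\<times>real\<times>real, t). f (fst p, fst (snd p), snd (snd p), t))"
    unfolding case_prod_unfold by (intro continuous_intros U_periodic_cont')
  from continuous_on_integral_last[OF this, of 0 1] show ?thesis
    by (simp add: siegel_mean1_def case_prod_unfold)
qed

lemma siegel_mean1_cont':
  "continuous_on A a \<Longrightarrow> continuous_on A b \<Longrightarrow> continuous_on A c \<Longrightarrow>
   continuous_on A (\<lambda>t. siegel_mean1 f (a t, b t, c t))"
  by (rule continuous_on_compose2[OF siegel_mean1_cont]) (auto intro!: continuous_intros)

lemma siegel_mean_cont: "continuous_on UNIV (siegel_mean f)"
proof -
  have "continuous_on UNIV (\<lambda>(p::real\<times>real, t). siegel_mean1 f (fst p, snd p, t))"
    unfolding case_prod_unfold by (intro continuous_intros siegel_mean1_cont')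
  from continuous_on_integral_last[OF this, of 0 1] show ?thesis
    by (simp add: siegel_mean_def case_prod_unfold)
qed

lemma siegel_mean_cont':
  "continuous_on A a \<Longrightarrow> continuous_on A b \<Longrightarrow> continuous_on A (\<lambda>t. siegel_mean f (a t, b t))"
  by (rule continuous_on_compose2[OF siegel_mean_cont]) (auto intro!: continuous_intros)

lemma integral_siegel_s1:
  assumes "\<alpha> > 0" "\<alpha> * L = real N"
  shows "integral {0..L} (\<lambda>s1. f (x, s3, s2, \<beta> + \<alpha> * s1)) = of_real L * siegel_mean1 f (x, s3, s2)"
  unfolding siegel_mean1_def prod.case
  by (rule integral_affine_periodic[of "\<lambda>t. f (x, s3, s2, t)", OF _ _ assms])
     (use f in \<open>auto intro!: continuous_intros U_periodic_cont' simp: U_periodic_def\<close>)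

lemma integral_siegel_s2:
  assumes "\<alpha> > 0" "\<alpha> * L = real N"
  shows "integral {0..L} (\<lambda>s2. siegel_mean1 f (x, s3, \<beta> + \<alpha> * s2)) = of_real L * siegel_mean f (x, s3)"
  unfolding siegel_mean_def prod.case
proof (rule integral_affine_periodic[of "\<lambda>t. siegel_mean1 f (x, s3, t)", OF _ _ assms])
  show "siegel_mean1 f (x, s3, t + 1) = siegel_mean1 f (x, s3, t)" for t
    using f by (simp add: siegel_mean1_def U_periodic_def)
qed (intro continuous_intros siegel_mean1_cont')

lemma siegel_mean_s3: "siegel_mean f (x, s3 + 1) = siegel_mean f (x, s3)"
  using f by (simp add: siegel_mean_def siegel_mean1_def U_periodic_def)

text \<open>
  The action of \<open>m(1)\<close> shears \<open>s1\<close> and \<open>s2\<close> but fixes \<open>s3\<close>, so averaging over \<open>s1\<close> and \<open>s2\<close> removes it.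
\<close>

lemma siegel_mean_x: "siegel_mean f (x + 1, s3) = siegel_mean f (x, s3)"
proof -
  have 1: "siegel_mean1 f (x + 1, s3, s2 + s3) = siegel_mean1 f (x, s3, s2)" for s2
  proof -
    have "siegel_mean1 f (x + 1, s3, s2 + s3) = integral {0..1} (\<lambda>s1. f (x + 1, s3, s2 + s3, (2 * s2 + s3) + 1 * s1))"
      using integral_siegel_s1[of 1 1 1] by simp
    also have "\<dots> = integral {0..1} (\<lambda>s1. f (x + 1, s3, s2 + s3, s1 + 2 * s2 + s3))"
      by (simp add: add_ac)
    also have "\<dots> = siegel_mean1 f (x, s3, s2)"
      using f by (simp add: siegel_mean1_def U_periodic_def)
    finally show ?thesis .
  qed
  have "siegel_mean f (x + 1, s3) = integral {0..1} (\<lambda>s2. siegel_mean1 f (x + 1, s3, s3 + 1 * s2))"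
    using integral_siegel_s2[of 1 1 1] by simp
  also have "\<dots> = siegel_mean f (x, s3)"
    using 1 by (simp add: siegel_mean_def add.commute)
  finally show ?thesis .
qed

definition partial_coef :: "nat \<Rightarrow> real \<Rightarrow> complex"
  where "partial_coef M2 x = integral {0..1} (\<lambda>s3. siegel_mean f (x, s3) * ee (- (real M2 * s3)))"

lemma partial_coef_cont: "continuous_on UNIV (partial_coef M)"
proof -
  have "continuous_on UNIV (\<lambda>(x, s3). siegel_mean f (x, s3) * ee (- (real M * s3)))"
    unfolding case_prod_unfold by (intro continuous_intros siegel_mean_cont')
  from continuous_on_integral_last[OF this, of 0 1] show ?thesis
    by (simp add: partial_coef_def[abs_def])
qed

lemma partial_coef_x: "partial_coef M (x + 1) = partial_coef M x"
  by (simp add: partial_coef_def siegel_mean_x)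

lemma fourier_coef_alt: "fourier_coef f M1 M2 = integral {0..1} (\<lambda>x. partial_coef M2 x * ee (- (real M1 * x)))"
  by (simp add: fourier_coef_def partial_coef_def)

end

lemma integral_cbox4:
  fixes f :: "real \<times> real \<times> real \<times> real \<Rightarrow> complex"
  assumes "continuous_on UNIV f"
  shows "integral (cbox (0,0,0,0) (a,b,c,d)) f =
    integral {0..a} (\<lambda>x. integral {0..b} (\<lambda>y. integral {0..c} (\<lambda>z. integral {0..d} (\<lambda>w. f (x,y,z,w)))))"
proof -
  note cont = continuous_on_compose2[OF assms]
  show ?thesis
    apply (subst integral_prod_continuous[OF continuous_on_subset[OF assms subset_UNIV]])
    apply (subst integral_prod_continuous)
     apply (rule cont; auto intro!: continuous_intros)
    apply (subst integral_prod_continuous)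
     apply (rule cont; auto intro!: continuous_intros)
    by simp
qed

text \<open>
  The integral of \<open>F\<close> against the conjugate of \<open>\<theta>\<close> over the cube of side \<open>L\<close>.
\<close>

definition twisted_box :: "nat \<Rightarrow> (real \<times> real \<times> real \<times> real \<Rightarrow> complex) \<Rightarrow> complex"
  where "twisted_box L F = integral (cbox (0,0,0,0) (real L, real L, real L, real L))
     (\<lambda>(x, s3, s2, s1). F (x, s3, s2, s1) * (ee (- x) * ee (- s3)))"

context
  fixes f :: "real \<times> real \<times> real \<times> real \<Rightarrow> complex"
    and F :: "real \<times> real \<times> real \<times> real \<Rightarrow> complex"
    and L :: nat and \<alpha>0 \<alpha>1 \<alpha>2 \<alpha>3 \<beta>0 \<beta>1 \<beta>2 \<beta>3 \<gamma> \<gamma>1 \<gamma>2 :: real and N0 N1 N2 N3 :: nat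
  assumes f: "U_periodic f"
  assumes F: "\<And>x s3 s2 s1. F (x, s3, s2, s1) =
       f (\<beta>0 + \<alpha>0 * x, \<beta>3 + \<alpha>3 * s3, \<beta>2 + \<alpha>2 * s2 + \<gamma> * s3, \<beta>1 + \<alpha>1 * s1 + \<gamma>1 * s2 + \<gamma>2 * s3)"
  assumes L: "L > 0"
  assumes \<alpha>: "\<alpha>0 > 0" "\<alpha>1 > 0" "\<alpha>2 > 0" "\<alpha>3 > 0"
  assumes N: "\<alpha>0 * real L = real N0" "\<alpha>1 * real L = real N1" "\<alpha>2 * real L = real N2" "\<alpha>3 * real L = real N3"
begin

lemma twisted_box_reduce:
  "twisted_box L F = of_nat L ^ 2 * integral {0..real L} (\<lambda>x. integral {0..real L} (\<lambda>s3.
     siegel_mean f (\<beta>0 + \<alpha>0 * x, \<beta>3 + \<alpha>3 * s3) * ee (- s3)) * ee (- x))"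
proof -
  have s1: "integral {0..real L} (\<lambda>s1. F (x, s3, s2, s1)) =
     of_nat L * siegel_mean1 f (\<beta>0 + \<alpha>0 * x, \<beta>3 + \<alpha>3 * s3, (\<beta>2 + \<gamma> * s3) + \<alpha>2 * s2)" for x s3 s2
    unfolding F using integral_siegel_s1[OF f \<alpha>(2) N(2), of _ _ _ "\<beta>1 + \<gamma>1 * s2 + \<gamma>2 * s3"]
    by (simp add: algebra_simps)
  have s2: "integral {0..real L} (\<lambda>s2. integral {0..real L} (\<lambda>s1. F (x, s3, s2, s1))) =
     of_nat L * (of_nat L * siegel_mean f (\<beta>0 + \<alpha>0 * x, \<beta>3 + \<alpha>3 * s3))" for x s3
    unfolding s1 integral_mult_right using integral_siegel_s2[OF f \<alpha>(3) N(3)] by simp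
  have "continuous_on UNIV (\<lambda>(x, s3, s2, s1). F (x, s3, s2, s1) * (ee (- x) * ee (- s3)))"
    unfolding case_prod_unfold F by (intro continuous_intros U_periodic_cont'[OF f])
  note I = integral_cbox4[OF this, of "real L" "real L" "real L" "real L"]
  have s3: "integral {0..real L} (\<lambda>s3. integral {0..real L} (\<lambda>s2. integral {0..real L}
        (\<lambda>s1. F (x, s3, s2, s1) * (ee (- x) * ee (- s3)))))
      = of_nat L ^ 2 * (integral {0..real L} (\<lambda>s3. siegel_mean f (\<beta>0 + \<alpha>0 * x, \<beta>3 + \<alpha>3 * s3) * ee (- s3)) * ee (- x))"
    (is "?l = ?r") for x
  proof -
    have "?l = integral {0..real L} (\<lambda>s3. (of_nat L ^ 2 * ee (- x)) * (siegel_mean f (\<beta>0 + \<alpha>0 * x, \<beta>3 + \<alpha>3 * s3) * ee (- s3)))"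
      by (simp only: integral_mult_left s2) (simp add: mult_ac power2_eq_square)
    then show ?thesis unfolding integral_mult_right by (simp only: mult_ac)
  qed
  show ?thesis unfolding twisted_box_def I prod.case s3 by simp
qed

text \<open>
  In the applications \<open>F\<close> is \<open>u \<mapsto> \<phi>(h u g)\<close>: left multiplication by \<open>h\<close> followed by the removal of its diagonal
  part is a triangular affine map in the coordinates of \<open>U_periodic\<close>.
\<close>

lemma twisted_box_coef:
  assumes "M1 > 0" "M2 > 0" "\<alpha>0 = 1 / real M1" "\<alpha>3 = 1 / real M2"
  shows "twisted_box L F = of_nat L ^ 4 * (ee (real M1 * \<beta>0) * ee (real M2 * \<beta>3) * fourier_coef f M1 M2)"
proof -
  have s3: "integral {0..real L} (\<lambda>s3. siegel_mean f (x, \<beta>3 + \<alpha>3 * s3) * ee (- s3))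
      = of_nat L * (ee (real M2 * \<beta>3) * partial_coef f M2 x)" for x
    using integral_affine_twisted[of "\<lambda>t. siegel_mean f (x, t)" M2 \<alpha>3 "real L" N3 \<beta>3] assms N
    by (simp add: partial_coef_def[OF f] siegel_mean_s3[OF f] siegel_mean_cont'[OF f])
  show ?thesis
    unfolding twisted_box_reduce s3
    using integral_affine_twisted[of "partial_coef f M2" M1 \<alpha>0 "real L" N0 \<beta>0, OF partial_coef_cont[OF f] partial_coef_x[OF f]] assms N
    by (simp add: fourier_coef_alt[OF f] mult.assoc power4_eq_xxxx power2_eq_square)
qed

lemma twisted_box_0:
  assumes "1 / \<alpha>0 \<notin> \<int> \<or> 1 / \<alpha>3 \<notin> \<int>"
  shows "twisted_box L F = 0"
proof (cases "1 / \<alpha>3 \<in> \<int>")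
  case False
  \<comment> \<open>The slope in \<open>s3\<close> already kills the inner integral.\<close>
  have s3: "integral {0..real L} (\<lambda>s3. siegel_mean f (x, \<beta>3 + \<alpha>3 * s3) * ee (- s3)) = 0" for x
    using integral_affine_twisted_0[of "\<lambda>t. siegel_mean f (x, t)" \<alpha>3 L N3 \<beta>3] N \<alpha> L False
    by (simp add: siegel_mean_s3[OF f] siegel_mean_cont'[OF f])
  then show ?thesis by (simp add: twisted_box_reduce)
next
  case True
  \<comment> \<open>The inner integral is a multiple of a periodic function of \<open>x\<close>, which the slope in \<open>x\<close> kills.\<close>
  then have 0: "1 / \<alpha>0 \<notin> \<int>" using assms by simp
  obtain M :: int where M: "1 / \<alpha>3 = of_int M" using True by (elim Ints_cases)
  with \<alpha> have M': "M > 0" by (metis of_int_0_less_iff zero_less_divide_1_iff)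
  have a: "\<alpha>3 = 1 / real (nat M)" using M M' \<alpha> by (simp add: field_simps)
  have s3: "integral {0..real L} (\<lambda>s3. siegel_mean f (x, \<beta>3 + \<alpha>3 * s3) * ee (- s3))
      = of_nat L * (ee (real (nat M) * \<beta>3) * partial_coef f (nat M) x)" for x
    using integral_affine_twisted[of "\<lambda>t. siegel_mean f (x, t)" "nat M" \<alpha>3 "real L" N3 \<beta>3] N M' a
    by (simp add: partial_coef_def[OF f] siegel_mean_s3[OF f] siegel_mean_cont'[OF f])
  show ?thesis
    unfolding twisted_box_reduce s3
    using integral_affine_twisted_0[of "partial_coef f (nat M)" \<alpha>0 L N0 \<beta>0, OF partial_coef_cont[OF f] partial_coef_x[OF f]] N \<alpha> 0 L
    by (simp add: mult.assoc)
qed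

end

section \<open>Fourier coefficients in symmetric coordinates\<close>

text \<open>
  The element \<open>n(S) m(x)\<close> of \<open>U(\<real>)\<close> described at \<open>U_periodic\<close>.
\<close>

definition usym :: "real \<Rightarrow> real \<Rightarrow> real \<Rightarrow> real \<Rightarrow> real^4^4"
  where "usym x s1 s2 s3 = umat x (s1 - x * s2) (s2 - x * s3) s3"

lemma umat_usym: "umat x12 x13 x23 x24 = usym x12 (x13 + x12 * (x23 + x12 * x24)) (x23 + x12 * x24) x24"
  by (simp add: usym_def)

lemma vector_4 [simp]:
  "(vector [a, b, c, d] :: 'a::zero^4) $ 1 = a"
  "(vector [a, b, c, d] :: 'a::zero^4) $ 2 = b"
  "(vector [a, b, c, d] :: 'a::zero^4) $ 3 = c"
  "(vector [a, b, c, d] :: 'a::zero^4) $ 4 = d"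
  unfolding vector_def by simp_all

lemma theta_umat: "theta M1 M2 (umat x12 x13 x23 x24) = ee (real M1 * x12 + real M2 * x24)"
  by (simp add: theta_def umat_def ee_def)

text \<open>
  For fixed \<open>x\<close> the passage from the matrix entries to \<open>S\<close> is a shear; on periodic functions it only
  translates each variable by an amount depending on the variables further out.
\<close>

lemma U_integral_eq_fourier_coef:
  assumes f: "U_periodic f" and \<Phi>: "\<And>x s1 s2 s3. \<Phi> (usym x s1 s2 s3) = f (x, s3, s2, s1)"
  shows "U_integral (\<lambda>u. \<Phi> u * cnj (theta M1 M2 u)) = fourier_coef f M1 M2"
proof -
  define c where "c = (\<lambda>x y. ee (- (real M1 * x)) * ee (- (real M2 * y)))"
  have c: "continuous_on S (\<lambda>t. c (a t) (b t))" if "continuous_on S a" "continuous_on S b" for S :: "'a::topological_space set" and a b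
    unfolding c_def by (intro continuous_intros that)
  define G where "G = (\<lambda>(x, x13, x23, s3). f (x, s3, x23 + x * s3, x13 + x * (x23 + x * s3)) * c x s3)"
  have Gc: "continuous_on S (\<lambda>t. G (a1 t, a2 t, a3 t, a4 t))"
    if "continuous_on S a1" "continuous_on S a2" "continuous_on S a3" "continuous_on S a4"
    for S :: "'a::topological_space set" and a1 a2 a3 a4
    unfolding G_def prod.case by (intro continuous_intros U_periodic_cont'[OF f] c that)
  have cth: "cnj (theta M1 M2 (usym x12 (x13 + x12 * (x23 + x12 * x24)) (x23 + x12 * x24) x24))
       = ee (- (real M1 * x12)) * ee (- (real M2 * x24))" for x12 x13 x23 x24
    unfolding umat_usym[symmetric] theta_umat cnj_ee by (simp add: ee_add[symmetric])
  have U: "U_integral (\<lambda>u. \<Phi> u * cnj (theta M1 M2 u)) = integral (cbox (0,0,0,0) (1,1,1,1)) G"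
    unfolding U_integral_def G_def c_def by (simp add: cth umat_usym \<Phi>)
  have inner: "integral {0..1} (\<lambda>x13. G (x, x13, x23, s3)) = siegel_mean1 f (x, s3, x * s3 + 1 * x23) * c x s3" for x x23 s3
    using integral_siegel_s1[OF f, of 1 1 1 x s3 "x * s3 + x23" "x * (x * s3 + x23)"]
    by (simp add: G_def add_ac)
  have middle: "integral (cbox (0,0,0) (1,1,1)) (\<lambda>q. G (x, q)) = integral {0..1} (\<lambda>s3. siegel_mean f (x, s3) * c x s3)" for x
  proof -
    have cont: "continuous_on UNIV (\<lambda>q. G (x, q))"
      using Gc[of UNIV "\<lambda>_. x" fst "\<lambda>q. fst (snd q)" "\<lambda>q. snd (snd q)"]
      by (simp add: continuous_intros)
    have "integral (cbox (0,0,0) (1,1,1)) (\<lambda>q. G (x, q))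
       = integral (cbox 0 1) (\<lambda>x13. integral (cbox (0,0) (1,1)) (\<lambda>q. G (x, x13, q)))"
      by (rule integral_prod_continuous[OF continuous_on_subset[OF cont subset_UNIV]])
    also have "\<dots> = integral (cbox (0,0) (1,1)) (\<lambda>q. integral (cbox 0 1) (\<lambda>x13. G (x, x13, q)))"
      by (rule integral_swap_continuous)
        (auto simp: case_prod_unfold intro!: continuous_on_compose2[OF cont] continuous_intros)
    also have "\<dots> = integral (cbox (0,0) (1,1)) (\<lambda>q. siegel_mean1 f (x, snd q, x * snd q + 1 * fst q) * c x (snd q))"
    proof -
      have "integral (cbox 0 1) (\<lambda>x13. G (x, x13, q)) = siegel_mean1 f (x, snd q, x * snd q + 1 * fst q) * c x (snd q)" for q
        using inner by (cases q) simp
      then show ?thesis by presburger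
    qed
    also have "\<dots> = integral (cbox 0 1) (\<lambda>x23. integral (cbox 0 1) (\<lambda>s3. siegel_mean1 f (x, s3, x * s3 + 1 * x23) * c x s3))"
      by (subst integral_prod_continuous) (auto intro!: continuous_intros siegel_mean1_cont'[OF f] c)
    also have "\<dots> = integral (cbox 0 1) (\<lambda>s3. integral (cbox 0 1) (\<lambda>x23. siegel_mean1 f (x, s3, x * s3 + 1 * x23) * c x s3))"
      by (rule integral_swap_continuous)
        (auto simp: case_prod_unfold intro!: continuous_intros siegel_mean1_cont'[OF f] c)
    also have "\<dots> = integral {0..1} (\<lambda>s3. siegel_mean f (x, s3) * c x s3)"
      using integral_siegel_s2[OF f, of 1 1 1 x] by simp
    finally show ?thesis .
  qed
  have "integral (cbox (0,0,0,0) (1,1,1,1)) G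
      = integral (cbox 0 1) (\<lambda>x. integral (cbox (0,0,0) (1,1,1)) (\<lambda>q. G (x, q)))"
    by (rule integral_prod_continuous)
       (use Gc[of _ fst "\<lambda>q. fst (snd q)" "\<lambda>q. fst (snd (snd q))" "\<lambda>q. snd (snd (snd q))"] in
         \<open>simp add: continuous_intros\<close>)
  also have "\<dots> = fourier_coef f M1 M2"
    unfolding middle fourier_coef_def c_def by (simp add: mult_ac integral_mult_right[symmetric])
  finally show ?thesis using U by simp
qed

section \<open>Symplectic matrices\<close>

lemmas mat4_simps = vec_eq_iff forall_4 matrix_matrix_mult_def sum_4 transpose_def mat_def

lemma Jmat_eq: "(Jmat :: 'a::comm_ring_1^4^4) = vector
   [vector [0, 0, 1, 0], vector [0, 0, 0, 1], vector [-1, 0, 0, 0], vector [0, -1, 0, 0]]"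
  by (simp add: Jmat_def block_def mat4_simps)

lemma mat_mult_Jmat: "mat m ** (Jmat :: 'a::comm_ring_1^4^4) = vector
   [vector [0, 0, m, 0], vector [0, 0, 0, m], vector [-m, 0, 0, 0], vector [0, -m, 0, 0]]"
  by (simp add: Jmat_eq mat4_simps)

lemma umat_mult_umat:
  "umat a b c d ** umat x y z w = umat (a + x) (y + a * z + b - (c + a * d) * x) (z + c - d * x) (d + w)"
  by (simp add: umat_def mat4_simps algebra_simps)

lemma usym_mult_usym:
  "usym n a b c ** usym x s1 s2 s3 =
   usym (x + n) (a + s1 + 2 * n * s2 + n ^ 2 * s3) (b + s2 + n * s3) (c + s3)"
  by (simp add: usym_def umat_mult_umat algebra_simps power2_eq_square)

lemma Sp4_mult: "g \<in> Sp4 \<Longrightarrow> h \<in> Sp4 \<Longrightarrow> g ** h \<in> (Sp4 :: ('a::comm_ring_1^4^4) set)"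
  by (simp add: Sp4_def matrix_transpose_mul) (metis matrix_mul_assoc)

lemma mat_1_Sp4: "mat 1 \<in> (Sp4 :: ('a::comm_ring_1^4^4) set)"
  by (simp add: Sp4_def transpose_mat)

lemma umat_Sp4: "umat a b c d \<in> Sp4"
  by (simp add: Sp4_def umat_def Jmat_eq mat4_simps algebra_simps)

lemma usym_Sp4: "usym x s1 s2 s3 \<in> Sp4"
  by (simp add: usym_def umat_Sp4)

lemma iota_Sp4: "y1 > 0 \<Longrightarrow> y2 > 0 \<Longrightarrow> iota y1 y2 \<in> Sp4"
  by (simp add: Sp4_def iota_def Jmat_eq mat4_simps)

lemma iota_mult: "iota a b ** iota c d = iota (a * c) (b * d)"
  by (simp add: iota_def mat4_simps real_sqrt_mult)

lemma mat_1_Kgrp: "mat 1 \<in> Kgrp"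
  by (simp add: Kgrp_def mat_1_Sp4 orthogonal_matrix_id)

lemma umat_0: "umat 0 0 0 0 = mat 1"
  by (simp add: umat_def mat4_simps)

lemma usym_int_Gamma0:
  "usym (of_int n) (of_int a) (of_int b) (of_int c) \<in> Gamma0 N"
proof -
  define g :: "int^4^4" where "g = vector [vector [1, n, a - n * b, b],
     vector [0, 1, b - n * c, c], vector [0, 0, 1, 0], vector [0, 0, - n, 1]]"
  have "g \<in> Sp4" by (simp add: g_def Sp4_def Jmat_eq mat4_simps algebra_simps)
  moreover have "usym (of_int n) (of_int a) (of_int b) (of_int c) = map_mat of_int g"
    by (simp add: g_def usym_def umat_def map_mat_def mat4_simps)
  moreover have "\<forall>i\<in>{3,4}. \<forall>j\<in>{1,2}. int N dvd g $ i $ j"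
    by (simp add: g_def)
  ultimately show ?thesis unfolding Gamma0_def by blast
qed

lemma continuous_umat [continuous_intros]:
  assumes "continuous_on S a" "continuous_on S b" "continuous_on S c" "continuous_on S d"
  shows "continuous_on S (\<lambda>t. umat (a t) (b t) (c t) (d t))"
proof -
  have "continuous_on S (\<lambda>t. \<chi> i j. umat (a t) (b t) (c t) (d t) $ i $ j)"
  proof (intro continuous_on_vec_lambda)
    fix i j :: 4
    show "continuous_on S (\<lambda>t. umat (a t) (b t) (c t) (d t) $ i $ j)"
      using exhaust_4[of i] exhaust_4[of j] assms
      by (elim disjE; simp add: umat_def continuous_intros)
  qed
  then show ?thesis by simp
qed

lemma continuous_matrix_mult_const [continuous_intros]:
  fixes g :: "real^4^4"
  assumes "continuous_on S f"
  shows "continuous_on S (\<lambda>t. f t ** g)"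
  unfolding matrix_matrix_mult_def by (intro continuous_intros assms)

lemma multiplier_eqI:
  assumes "transpose g ** Jmat ** g = mat m ** Jmat"
  shows "multiplier g = m"
  unfolding multiplier_def
proof (rule the_equality, rule assms)
  fix m' assume "transpose g ** Jmat ** g = mat m' ** Jmat"
  then have "(mat m ** Jmat :: real^4^4) = mat m' ** Jmat" using assms by simp
  then show "m' = m" by (simp add: mat4_simps Jmat_eq)
qed

lemma map_mat_mult: "map_mat of_int (A ** B) = (map_mat of_int A ** map_mat of_int B :: real^4^4)"
  by (simp add: map_mat_def matrix_matrix_mult_def)

lemma multiplier_Smat:
  assumes "h \<in> Smat m" "g \<in> Sp4"
  shows "multiplier (map_mat of_int h ** g) = real m"
proof (rule multiplier_eqI)
  let ?h = "map_mat of_int h :: real^4^4"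
  have "transpose h ** Jmat ** h = mat (int m) ** Jmat" using assms by (simp add: Smat_def)
  then have "(map_mat of_int (transpose h ** Jmat ** h) :: real^4^4) = map_mat of_int (mat (int m) ** Jmat)"
    by simp
  moreover have "map_mat of_int (transpose h) = transpose ?h"
    by (simp add: map_mat_def transpose_def)
  moreover have "map_mat of_int Jmat = (Jmat :: real^4^4)"
    by (simp add: Jmat_eq map_mat_def mat4_simps)
  moreover have "map_mat of_int (mat (int m)) = (mat (real m) :: real^4^4)"
    by (simp add: map_mat_def mat4_simps)
  ultimately have h: "transpose ?h ** Jmat ** ?h = mat (real m) ** Jmat"
    by (simp add: map_mat_mult)
  have "transpose (?h ** g) ** Jmat ** (?h ** g) = transpose g ** (transpose ?h ** Jmat ** ?h) ** g"
    by (simp add: matrix_transpose_mul matrix_mul_assoc)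
  also have "\<dots> = real m *\<^sub>R (transpose g ** Jmat ** g)"
    unfolding h mat_mult_Jmat by (simp add: Jmat_eq mat4_simps algebra_simps)
  also have "\<dots> = mat (real m) ** Jmat"
    using assms(2) by (simp add: Sp4_def mat_mult_Jmat) (simp add: Jmat_eq mat4_simps)
  finally show "transpose (?h ** g) ** Jmat ** (?h ** g) = mat (real m) ** Jmat" .
qed

text \<open>
  The matrix \<open>(A, m\<^sup>-\<^sup>1BD; 0, D)\<close> with \<open>D = m A\<^sup>-\<^sup>T\<close>, so that \<open>m\<^sup>-\<^sup>1BD = B A\<^sup>-\<^sup>T\<close>.
\<close>

definition hecke_rep :: "real \<Rightarrow> real \<Rightarrow> real \<Rightarrow> real \<Rightarrow> real \<Rightarrow> real \<Rightarrow> real \<Rightarrow> real^4^4"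
  where "hecke_rep m a1 a2 a b1 b2 b3 = vector [
     vector [a1, a, b1 / a1 - b2 * a / (a1 * a2), b2 / a2],
     vector [0, a2, b2 / a1 - b3 * a / (a1 * a2), b3 / a2],
     vector [0, 0, m / a1, 0],
     vector [0, 0, - (m * a / (a1 * a2)), m / a2]]"

text \<open>
  With \<open>h = n(B/m) diag(A, D)\<close> one has \<open>h n(S) = n((B + A S A\<^sup>T)/m) diag(A, D)\<close>; the upper triangular
  \<open>A m(x)\<close> splits into \<open>m((a + a\<^sub>1 x)/a\<^sub>2)\<close> and \<open>diag(a\<^sub>1, a\<^sub>2)\<close>.
\<close>

lemma hecke_rep_mult_usym:
  assumes "m > 0" "a1 > 0" "a2 > 0"
  shows "(1 / sqrt m) *\<^sub>R (hecke_rep m a1 a2 a b1 b2 b3 ** usym x s1 s2 s3) =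
    usym (a / a2 + a1 / a2 * x)
        (b1 / m + a1 ^ 2 / m * s1 + 2 * a * a1 / m * s2 + a ^ 2 / m * s3)
        (b2 / m + a1 * a2 / m * s2 + a * a2 / m * s3)
        (b3 / m + a2 ^ 2 / m * s3) ** iota (a1 / a2) (a2 ^ 2 / m)"
proof -
  define r where "r = sqrt m"
  have r: "r > 0" "m = r * r" using assms by (auto simp: r_def)
  have s: "sqrt (a2 ^ 2 / m) = a2 / r" using assms by (simp add: r_def real_sqrt_divide)
  have I: "iota (a1 / a2) (a2 ^ 2 / m) = vector [vector [a1 / r, 0, 0, 0], vector [0, a2 / r, 0, 0],
      vector [0, 0, r / a1, 0], vector [0, 0, 0, r / a2]]"
    using assms by (simp add: iota_def s mat4_simps)
  show ?thesis
    unfolding I r_def[symmetric] unfolding usym_def umat_def hecke_rep_def r(2)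
    using assms r(1) by (simp add: mat4_simps) (simp add: field_simps power2_eq_square)
qed

section \<open>The Iwasawa decomposition\<close>

definition symp :: "real^4 \<Rightarrow> real^4 \<Rightarrow> real"
  where "symp v w = v$1 * w$3 + v$2 * w$4 - v$3 * w$1 - v$4 * w$2"

lemma Sp4_transpose:
  fixes g :: "real^4^4"
  assumes "g \<in> Sp4"
  shows "g ** Jmat ** transpose g = Jmat"
proof -
  define N :: "real^4^4" where "N = - Jmat"
  have JN: "Jmat ** N = mat 1" "N ** Jmat = mat 1"
    by (simp_all add: N_def Jmat_eq mat4_simps)
  have "(N ** transpose g ** Jmat) ** g = N ** (transpose g ** Jmat ** g)"
    by (simp add: matrix_mul_assoc)
  also have "\<dots> = mat 1" using assms by (simp add: Sp4_def JN)
  finally have "g ** (N ** transpose g ** Jmat) = mat 1"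
    using matrix_left_right_inverse by blast
  then have "g ** N ** transpose g ** (Jmat ** N) = N" by (simp add: matrix_mul_assoc)
  then have "g ** N ** transpose g = N" by (simp add: JN)
  moreover have "g ** N ** transpose g = - (g ** Jmat ** transpose g)"
    unfolding N_def by (simp add: matrix_matrix_mult_def vec_eq_iff sum_negf)
  ultimately show ?thesis by (simp add: N_def)
qed

lemma symp_Jmat: "(g ** Jmat ** transpose g) $ i $ j = symp (g $ i) (g $ j)"
  by (simp add: symp_def Jmat_eq matrix_matrix_mult_def sum_4 transpose_def algebra_simps)

lemma Sp4_symp:
  assumes "g \<in> Sp4"
  shows "symp (g$1) (g$2) = 0" "symp (g$1) (g$3) = 1" "symp (g$1) (g$4) = 0"
    "symp (g$2) (g$3) = 0" "symp (g$2) (g$4) = 1" "symp (g$3) (g$4) = 0"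
  unfolding symp_Jmat[symmetric] Sp4_transpose[OF assms] by (simp_all add: Jmat_eq)

lemma det_4:
  "det (A::'a::comm_ring_1^4^4) =
    A$1$1 * (A$2$2 * (A$3$3 * A$4$4 - A$3$4 * A$4$3) - A$2$3 * (A$3$2 * A$4$4 - A$3$4 * A$4$2) + A$2$4 * (A$3$2 * A$4$3 - A$3$3 * A$4$2))
  - A$1$2 * (A$2$1 * (A$3$3 * A$4$4 - A$3$4 * A$4$3) - A$2$3 * (A$3$1 * A$4$4 - A$3$4 * A$4$1) + A$2$4 * (A$3$1 * A$4$3 - A$3$3 * A$4$1))
  + A$1$3 * (A$2$1 * (A$3$2 * A$4$4 - A$3$4 * A$4$2) - A$2$2 * (A$3$1 * A$4$4 - A$3$4 * A$4$1) + A$2$4 * (A$3$1 * A$4$2 - A$3$2 * A$4$1))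
  - A$1$4 * (A$2$1 * (A$3$2 * A$4$3 - A$3$3 * A$4$2) - A$2$2 * (A$3$1 * A$4$3 - A$3$3 * A$4$1) + A$2$3 * (A$3$1 * A$4$2 - A$3$2 * A$4$1))"
proof -
  have f1: "finite {2::4, 3, 4}" "1 \<notin> {2::4, 3, 4}" by auto
  have f2: "finite {3::4, 4}" "2 \<notin> {3::4, 4}" by auto
  have f3: "finite {4::4}" "3 \<notin> {4::4}" by auto
  have U: "UNIV = {1::4, 2, 3, 4}" using exhaust_4 by auto
  show ?thesis
    unfolding det_def U
    unfolding sum_over_permutations_insert[OF f1]
    unfolding sum_over_permutations_insert[OF f2]
    unfolding sum_over_permutations_insert[OF f3]
    unfolding permutes_sing
    apply (simp add: sign_swap_id permutation_swap_id sign_compose permutation_compose sign_id swap_id_eq)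
    apply (simp add: algebra_simps)
    done
qed

text \<open>
  Multiplication by \<open>J\<close>, so that the symplectic form of \<open>v\<close> and \<open>w\<close> is the inner product of \<open>v\<close> with \<open>J_rotate w\<close>.
\<close>

definition J_rotate :: "real^4 \<Rightarrow> real^4"
  where "J_rotate v = vector [v$3, v$4, - v$1, - v$2]"

lemma inner_4: "(v::real^4) \<bullet> w = v$1 * w$1 + v$2 * w$2 + v$3 * w$3 + v$4 * w$4"
  by (simp add: inner_vec_def sum_4)

text \<open>
  Such a matrix is the unitary \<open>P + iQ\<close> written as \<open>(P, Q; -Q, P)\<close>.  Its determinant is the sum of two squares
  \<open>|det(P + iQ)|\<^sup>2\<close>, hence not \<open>-1\<close>.
\<close>

lemma unitary_Kgrp:
  assumes "u \<bullet> u = 1" "v \<bullet> v = 1" "u \<bullet> v = 0" "symp u v = 0"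
  shows "vector [J_rotate u, J_rotate v, u, v] \<in> Kgrp"
proof -
  define k :: "real^4^4" where "k = vector [J_rotate u, J_rotate v, u, v]"
  have kk: "k ** transpose k = mat 1"
    using assms by (simp add: k_def mat4_simps J_rotate_def inner_4 symp_def algebra_simps)
  then have o: "orthogonal_matrix k"
    by (simp add: orthogonal_matrix_def matrix_left_right_inverse)
  \<comment> \<open>Commuting with \<open>J\<close> turns orthogonality into the symplectic relation.\<close>
  have kJ: "Jmat ** k = k ** Jmat"
    by (simp add: k_def Jmat_eq mat4_simps J_rotate_def)
  have "transpose k ** Jmat ** k = transpose k ** k ** Jmat"
    by (simp add: matrix_mul_assoc[symmetric] kJ)
  then have "k \<in> Sp4" using o by (simp add: Sp4_def orthogonal_matrix_def)
  moreover have "det k = ((u$3 * v$4 - u$4 * v$3) - (u$1 * v$2 - u$2 * v$1)) ^ 2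
      + (u$1 * v$4 - u$4 * v$1 + u$3 * v$2 - u$2 * v$3) ^ 2"
    by (simp add: det_4 k_def J_rotate_def algebra_simps power2_eq_square)
  then have "det k \<ge> 0" by simp
  then have "det k = 1" using det_orthogonal_matrix[OF o] by auto
  ultimately show ?thesis using o by (simp add: Kgrp_def k_def)
qed

lemma Sp4_lower_triangular:
  assumes "b \<in> Sp4" "b $ 3 = vector [0, 0, s, 0]" "b $ 4 = vector [0, 0, l, t]" "s > 0" "t > 0"
  shows "\<exists>x\<in>Ugrp. \<exists>y1>0. \<exists>y2>0. b = x ** iota y1 y2"
proof -
  note om = Sp4_symp[OF assms(1)]
  have e: "b $ 1 $ 1 = 1 / s" "b $ 2 $ 1 = 0"
    using om(2,4) assms by (auto simp: symp_def field_simps)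
  have e2: "b $ 2 $ 2 = 1 / t" using om(5) assms by (simp add: symp_def e field_simps)
  have e3: "b $ 1 $ 2 = - l / (s * t)" using om(3) assms by (simp add: symp_def e field_simps)
  have e4: "b $ 1 $ 4 = (b $ 2 $ 3 / s - l / (s * t) * b $ 2 $ 4) * t"
    using om(1) assms by (simp add: symp_def e e2 e3 field_simps)
  define x where "x = umat (- l / s) (b $ 1 $ 3 / s) (b $ 2 $ 3 / s) (b $ 2 $ 4 / t)"
  have sq: "sqrt (1 / t ^ 2) = 1 / t" using assms by (simp add: real_sqrt_divide)
  have "b = x ** iota (t / s) (1 / t ^ 2)"
    unfolding x_def iota_def sq
    using assms(2-5) by (simp add: mat4_simps umat_def e e2 e3 e4 field_simps)
  moreover have "x \<in> Ugrp" by (auto simp: x_def Ugrp_def)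
  ultimately show ?thesis using assms by (metis zero_less_divide_iff zero_less_one zero_less_power)
qed

lemma symp_scaleR: "symp (a *\<^sub>R v) w = a * symp v w" "symp v (a *\<^sub>R w) = a * symp v w"
  by (simp_all add: symp_def algebra_simps)

lemma symp_add: "symp (v + w) z = symp v z + symp w z"
  by (simp add: symp_def algebra_simps)

lemma symp_diff: "symp v (w - z) = symp v w - symp v z"
  by (simp add: symp_def algebra_simps)

text \<open>
  Gram--Schmidt applied to the two lower rows of \<open>g\<close> gives the lower rows of \<open>k\<close>.  They span a Lagrangian plane,
  so they determine \<open>k\<close>, and \<open>g k\<^sup>T\<close> is a symplectic matrix with lower block \<open>(0, D)\<close>, \<open>D\<close> lower triangular;
  the symplectic relations force its remaining entries into the shape \<open>x \<iota>(y)\<close>.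
\<close>

lemma iwasawa:
  assumes g: "g \<in> Sp4"
  shows "\<exists>x\<in>Ugrp. \<exists>y1>0. \<exists>y2>0. \<exists>k\<in>Kgrp. g = x ** iota y1 y2 ** k"
proof -
  define c d where "c = g $ 3" and "d = g $ 4"
  note om = Sp4_symp[OF g]
  have c0: "c \<noteq> 0" using om(2) by (auto simp: c_def symp_def)
  define r where "r = (c \<bullet> d) / (c \<bullet> c)"
  \<comment> \<open>The component of \<open>d\<close> orthogonal to \<open>c\<close>; it is nonzero since it pairs to 1 with the second row.\<close>
  define w where "w = d - r *\<^sub>R c"
  have cc: "c \<bullet> c > 0" using c0 by simp
  have "symp (g $ 2) w = 1" unfolding w_def symp_diff symp_scaleR c_def d_def using om by simp
  then have w0: "w \<noteq> 0" by (auto simp: symp_def)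
  have cw: "c \<bullet> w = 0" using cc by (simp add: w_def r_def inner_diff_right)
  have "symp c c = 0" by (simp add: symp_def)
  then have ocw: "symp c w = 0" unfolding w_def symp_diff symp_scaleR using om(6) by (simp add: c_def d_def)
  define s t where "s = norm c" and "t = norm w"
  have st: "s > 0" "t > 0" using c0 w0 by (auto simp: s_def t_def)
  define u v where "u = (1 / s) *\<^sub>R c" and "v = (1 / t) *\<^sub>R w"
  have uv: "u \<bullet> u = 1" "v \<bullet> v = 1" "u \<bullet> v = 0" "symp u v = 0"
    using c0 w0 cw ocw
    by (simp_all add: u_def v_def s_def t_def symp_scaleR power2_norm_eq_inner[symmetric] power2_eq_square)
  define k :: "real^4^4" where "k = vector [J_rotate u, J_rotate v, u, v]"
  have k: "k \<in> Kgrp" unfolding k_def by (rule unitary_Kgrp[OF uv])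
  then have kk: "transpose k ** k = mat 1" "k ** transpose k = mat 1"
    by (simp_all add: Kgrp_def orthogonal_matrix_def)
  have "transpose k \<in> Sp4"
    using k Sp4_transpose[of k] by (simp add: Kgrp_def Sp4_def)
  then have b: "g ** transpose k \<in> Sp4" by (rule Sp4_mult[OF g])
  have row: "(g ** transpose k) $ i = vector [g $ i \<bullet> J_rotate u, g $ i \<bullet> J_rotate v, g $ i \<bullet> u, g $ i \<bullet> v]" for i
    by (simp add: k_def mat4_simps inner_4)
  have inner_J_rotate: "x \<bullet> J_rotate y = symp x y" for x y by (simp add: inner_4 symp_def J_rotate_def)
  have cu: "c = s *\<^sub>R u" "d = t *\<^sub>R v + (r * s) *\<^sub>R u"
    using st by (simp_all add: u_def v_def w_def)
  have self: "symp u u = 0" "symp v v = 0" "symp v u = 0" using uv(4) by (simp_all add: symp_def algebra_simps)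
  have "(g ** transpose k) $ 3 = vector [0, 0, s, 0]"
    unfolding row c_def[symmetric] inner_J_rotate cu(1) symp_scaleR using uv self by simp
  moreover have "(g ** transpose k) $ 4 = vector [0, 0, r * s, t]"
  proof -
    have "symp d u = 0" "symp d v = 0"
      unfolding cu(2) symp_add symp_scaleR using self uv(4) by simp_all
    moreover have "d \<bullet> u = r * s" "d \<bullet> v = t"
      unfolding cu(2) using uv by (simp_all add: inner_add_left inner_commute[of v u])
    ultimately show ?thesis unfolding row d_def[symmetric] inner_J_rotate by simp
  qed
  ultimately obtain x y1 y2 where xy: "x \<in> Ugrp" "y1 > 0" "y2 > 0" "g ** transpose k = x ** iota y1 y2"
    using Sp4_lower_triangular[OF b _ _ st] by blast
  then have "x ** iota y1 y2 ** k = g" using kk by (metis matrix_mul_assoc matrix_mul_rid)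
  then show ?thesis using xy k by metis
qed

section \<open>Representatives of the Hecke cosets\<close>

type_synonym hpar = "int \<times> int \<times> int \<times> int \<times> int \<times> int"

text \<open>
  The parameters \<open>(a1, a2, a, b1, b2, b3)\<close> for which \<open>D = m A\<^sup>-\<^sup>T\<close> and \<open>m\<^sup>-\<^sup>1BD\<close> are integral.  The number
  \<open>a * (m div a2) div a1\<close> is minus the entry of \<open>D\<close> below the diagonal.
\<close>

definition hecke_params :: "nat \<Rightarrow> hpar set"
  where "hecke_params m = {(a1, a2, a, b1, b2, b3). a1 > 0 \<and> a2 > 0 \<and> 0 \<le> a \<and> a < a2 \<and>
     {b1, b2, b3} \<subseteq> {0..<int m} \<and> a1 dvd int m \<and> a2 dvd int m \<and> a1 dvd a * (int m div a2) \<and>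
     int m dvd b1 * (int m div a1) - b2 * (a * (int m div a2) div a1) \<and>
     int m dvd b2 * (int m div a2) \<and>
     int m dvd b2 * (int m div a1) - b3 * (a * (int m div a2) div a1) \<and>
     int m dvd b3 * (int m div a2)}"

definition hecke_mat :: "nat \<Rightarrow> hpar \<Rightarrow> int^4^4"
  where "hecke_mat m = (\<lambda>(a1, a2, a, b1, b2, b3). vector [
     vector [a1, a, (b1 * (int m div a1) - b2 * (a * (int m div a2) div a1)) div int m, b2 * (int m div a2) div int m],
     vector [0, a2, (b2 * (int m div a1) - b3 * (a * (int m div a2) div a1)) div int m, b3 * (int m div a2) div int m],
     vector [0, 0, int m div a1, 0],
     vector [0, 0, - (a * (int m div a2) div a1), int m div a2]])"

lemma vector_2' [simp]:
  "(vector [a, b] :: 'a::zero^2) $ 1 = a" "(vector [a, b] :: 'a::zero^2) $ 2 = b"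
  unfolding vector_def by simp_all

lemma hecke_mat_real:
  assumes "m > 0" "(a1, a2, a, b1, b2, b3) \<in> hecke_params m"
  shows "map_mat of_int (hecke_mat m (a1, a2, a, b1, b2, b3)) =
     hecke_rep (real m) (of_int a1) (of_int a2) (of_int a) (of_int b1) (of_int b2) (of_int b3)"
proof -
  from assms have pos: "a1 > 0" "a2 > 0" and d: "a1 dvd int m" "a2 dvd int m" "a1 dvd a * (int m div a2)"
     "int m dvd b1 * (int m div a1) - b2 * (a * (int m div a2) div a1)" "int m dvd b2 * (int m div a2)"
     "int m dvd b2 * (int m div a1) - b3 * (a * (int m div a2) div a1)" "int m dvd b3 * (int m div a2)"
    by (auto simp: hecke_params_def)
  have r: "(x * (real m / a1) - y * (a * (real m / a2) / a1)) / real m = x / a1 - y * a / (a1 * a2)"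
    "x * (real m / a2) / real m = x / a2" for x y a1 a2 a :: real
    using assms(1) by (simp_all add: field_simps)
  show ?thesis
    using pos assms(1)
    by (simp add: map_mat_def hecke_mat_def hecke_rep_def mat4_simps real_of_int_div[OF d(1)] real_of_int_div[OF d(2)]
       real_of_int_div[OF d(3)] real_of_int_div[OF d(4)] real_of_int_div[OF d(5)] real_of_int_div[OF d(6)]
       real_of_int_div[OF d(7)] r) (simp add: diff_divide_distrib mult.commute)
qed

lemma inj_map_mat_of_int: "map_mat of_int g = (map_mat of_int h :: real^4^4) \<Longrightarrow> g = h"
  by (simp add: map_mat_def vec_eq_iff)

lemma inj_on_hecke_mat:
  assumes m: "m > 0"
  shows "inj_on (hecke_mat m) (hecke_params m)"
proof (rule inj_onI)
  fix P Q assume P: "P \<in> hecke_params m" and Q: "Q \<in> hecke_params m" and eq: "hecke_mat m P = hecke_mat m Q"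
  obtain a1 a2 a b1 b2 b3 where Pe: "P = (a1, a2, a, b1, b2, b3)" by (cases P)
  obtain a1' a2' a' b1' b2' b3' where Qe: "Q = (a1', a2', a', b1', b2', b3')" by (cases Q)
  have pos: "a1 > 0" "a2 > 0" using P by (auto simp: Pe hecke_params_def)
  have aeq: "a1' = a1" "a2' = a2" "a' = a" using eq by (simp_all add: Pe Qe hecke_mat_def mat4_simps)
  have "hecke_rep (real m) (of_int a1) (of_int a2) (of_int a) (of_int b1) (of_int b2) (of_int b3) =
     hecke_rep (real m) (of_int a1) (of_int a2) (of_int a) (of_int b1') (of_int b2') (of_int b3')"
    using eq hecke_mat_real[OF m, of a1 a2 a b1 b2 b3] hecke_mat_real[OF m, of a1' a2' a' b1' b2' b3'] P Q
    by (simp add: Pe Qe aeq)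
  note heq = this
  from arg_cong[OF heq, of "\<lambda>H. H $ 1 $ 4"] arg_cong[OF heq, of "\<lambda>H. H $ 2 $ 4"]
  have b: "b2 = b2'" "b3 = b3'" using pos by (simp_all add: hecke_rep_def)
  from arg_cong[OF heq, of "\<lambda>H. H $ 1 $ 3"] have "b1 = b1'" using pos b by (simp add: hecke_rep_def)
  then show "P = Q" using b by (simp add: Pe Qe aeq)
qed

lemma usym_0: "usym 0 0 0 0 = mat 1"
  by (simp add: usym_def umat_0)

lemma Sp4_scaled:
  fixes H :: "real^4^4"
  assumes "(1 / sqrt m) *\<^sub>R H \<in> Sp4" "m > 0"
  shows "transpose H ** Jmat ** H = mat m ** Jmat"
proof -
  have "transpose (c *\<^sub>R H) ** Jmat ** (c *\<^sub>R H) = (c * c) *\<^sub>R (transpose H ** Jmat ** H)" for c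
    by (simp add: transpose_def matrix_matrix_mult_def vec_eq_iff sum_distrib_left mult_ac)
  from this[of "1 / sqrt m"] have "(1 / m) *\<^sub>R (transpose H ** Jmat ** H) = Jmat"
    using assms by (simp add: Sp4_def)
  then have "m *\<^sub>R ((1 / m) *\<^sub>R (transpose H ** Jmat ** H)) = m *\<^sub>R Jmat" by simp
  then have "transpose H ** Jmat ** H = m *\<^sub>R Jmat" using assms by simp
  also have "\<dots> = mat m ** Jmat" unfolding mat_mult_Jmat by (simp add: Jmat_eq mat4_simps)
  finally show ?thesis .
qed

lemma hecke_mat_Smat:
  assumes m: "m > 0" and P: "P \<in> hecke_params m"
  shows "hecke_mat m P \<in> Smat m"
proof -
  obtain a1 a2 a b1 b2 b3 where Pe: "P = (a1, a2, a, b1, b2, b3)" by (cases P)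
  have pos: "a1 > 0" "a2 > 0" using P by (auto simp: Pe hecke_params_def)
  let ?h = "hecke_mat m P" and ?H = "hecke_rep (real m) (of_int a1) (of_int a2) (of_int a) (of_int b1) (of_int b2) (of_int b3)"
  have real: "map_mat of_int ?h = ?H" using hecke_mat_real[OF m] P by (simp add: Pe)
  have "(1 / sqrt (real m)) *\<^sub>R (?H ** usym 0 0 0 0) \<in> Sp4"
    using pos m by (subst hecke_rep_mult_usym) (auto intro!: Sp4_mult usym_Sp4 iota_Sp4)
  then have "(1 / sqrt (real m)) *\<^sub>R ?H \<in> Sp4" by (simp add: usym_0)
  then have "transpose ?H ** Jmat ** ?H = mat (real m) ** Jmat"
    by (rule Sp4_scaled) (use m in auto)
  moreover have "map_mat of_int (transpose ?h) = transpose ?H"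
    unfolding real[symmetric] by (simp add: map_mat_def transpose_def)
  moreover have "map_mat of_int Jmat = (Jmat :: real^4^4)"
    by (simp add: Jmat_eq map_mat_def mat4_simps)
  moreover have "map_mat of_int (mat (int m)) = (mat (real m) :: real^4^4)"
    by (simp add: map_mat_def mat4_simps)
  ultimately have "map_mat of_int (transpose ?h ** Jmat ** ?h) = (map_mat of_int (mat (int m) ** Jmat) :: real^4^4)"
    by (simp add: map_mat_mult real)
  then show ?thesis using inj_map_mat_of_int by (auto simp: Smat_def)
qed

lemma Hset_eq:
  assumes m: "m > 0"
  shows "Hset m = hecke_mat m ` hecke_params m"
proof (intro equalityI subsetI)
  fix h assume "h \<in> Hset m"
  then obtain a1 a2 a b1 b2 b3 and A B C D :: "int^2^2" where
    A: "A = vector [vector [a1, a], vector [0, a2]]" and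
    B: "B = vector [vector [b1, b2], vector [b2, b3]]" and
    r: "a1 > 0" "a2 > 0" "0 \<le> a" "a < a2" "{b1, b2, b3} \<subseteq> {0..<int m}" and
    AD: "A ** transpose D = mat (int m)" and BD: "B ** D = mat (int m) ** C" and h: "h = block A C 0 D"
    unfolding Hset_def by blast
  have D: "D $ 1 $ 2 = 0" "a1 * D $ 1 $ 1 = int m" "a2 * D $ 2 $ 2 = int m" "a1 * D $ 2 $ 1 + a * D $ 2 $ 2 = 0"
    using AD r by (auto simp: A vec_eq_iff forall_2 matrix_matrix_mult_def sum_2 transpose_def mat_def)
  have C: "b1 * D $ 1 $ 1 + b2 * D $ 2 $ 1 = int m * C $ 1 $ 1" "b2 * D $ 2 $ 2 = int m * C $ 1 $ 2"
     "b2 * D $ 1 $ 1 + b3 * D $ 2 $ 1 = int m * C $ 2 $ 1" "b3 * D $ 2 $ 2 = int m * C $ 2 $ 2"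
    using BD D(1) by (auto simp: B vec_eq_iff forall_2 matrix_matrix_mult_def sum_2 mat_def)
  have D1: "int m div a1 = D $ 1 $ 1" using r nonzero_mult_div_cancel_left[of a1 "D $ 1 $ 1"] unfolding D(2) by simp
  have D2: "int m div a2 = D $ 2 $ 2" using r nonzero_mult_div_cancel_left[of a2 "D $ 2 $ 2"] unfolding D(3) by simp
  have dvd: "a1 dvd int m" "a2 dvd int m" by (metis D(2) dvd_triv_left, metis D(3) dvd_triv_left)
  have aD: "a * D $ 2 $ 2 = a1 * (- D $ 2 $ 1)" using D(4) by (simp add: algebra_simps)
  then have D3: "a * D $ 2 $ 2 div a1 = - D $ 2 $ 1" and D3': "a1 dvd a * D $ 2 $ 2"
    using r by (auto simp del: mult_minus_right)
  have "(a1, a2, a, b1, b2, b3) \<in> hecke_params m"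
    using r C D3' dvd unfolding hecke_params_def mem_Collect_eq prod.case D1 D2 D3 by simp
  moreover have "h = hecke_mat m (a1, a2, a, b1, b2, b3)"
    unfolding hecke_mat_def prod.case D1 D2 D3 h block_def using C m D(1) by (simp add: A mat4_simps)
  ultimately show "h \<in> hecke_mat m ` hecke_params m" by blast
next
  fix h assume "h \<in> hecke_mat m ` hecke_params m"
  then obtain a1 a2 a b1 b2 b3 where P: "(a1, a2, a, b1, b2, b3) \<in> hecke_params m" and
    h: "h = hecke_mat m (a1, a2, a, b1, b2, b3)" by force
  define D1 D2 D3 where "D1 = int m div a1" and "D2 = int m div a2" and "D3 = a * D2 div a1"
  from P have r: "a1 > 0" "a2 > 0" "0 \<le> a" "a < a2" "{b1, b2, b3} \<subseteq> {0..<int m}"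
    and d: "a1 dvd int m" "a2 dvd int m" "a1 dvd a * D2"
    and c: "int m dvd b1 * D1 - b2 * D3" "int m dvd b2 * D2" "int m dvd b2 * D1 - b3 * D3" "int m dvd b3 * D2"
    by (auto simp: hecke_params_def D1_def D2_def D3_def)
  define A B C D :: "int^2^2" where "A = vector [vector [a1, a], vector [0, a2]]" and
    "B = vector [vector [b1, b2], vector [b2, b3]]" and
    "C = vector [vector [(b1 * D1 - b2 * D3) div int m, b2 * D2 div int m],
                 vector [(b2 * D1 - b3 * D3) div int m, b3 * D2 div int m]]" and
    "D = vector [vector [D1, 0], vector [- D3, D2]]"
  have "a1 * D1 = int m" "a2 * D2 = int m" "a1 * D3 = a * D2"
    using d by (simp_all add: D1_def D2_def D3_def)
  then have "A ** transpose D = mat (int m)"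
    by (simp add: A_def D_def vec_eq_iff forall_2 matrix_matrix_mult_def sum_2 transpose_def mat_def)
  moreover have "B ** D = mat (int m) ** C"
    using c by (simp add: B_def C_def D_def vec_eq_iff forall_2 matrix_matrix_mult_def sum_2 mat_def)
  moreover have "h = block A C 0 D"
    unfolding h by (simp add: hecke_mat_def block_def A_def C_def D_def D1_def D2_def D3_def mat4_simps)
  moreover have "h \<in> Smat m" unfolding h by (rule hecke_mat_Smat[OF m P])
  ultimately show "h \<in> Hset m" unfolding Hset_def mem_Collect_eq using r A_def B_def by blast
qed

lemma finite_hecke_params: "m > 0 \<Longrightarrow> finite (hecke_params m)"
proof -
  assume m: "m > 0"
  have "hecke_params m \<subseteq> {0..int m} \<times> {0..int m} \<times> {0..int m} \<times> {0..int m} \<times> {0..int m} \<times> {0..int m}"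
  proof
    fix P assume P: "P \<in> hecke_params m"
    obtain a1 a2 a b1 b2 b3 where Pe: "P = (a1, a2, a, b1, b2, b3)" by (cases P)
    have "a1 \<le> int m" "a2 \<le> int m" using P m by (auto simp: Pe hecke_params_def intro!: zdvd_imp_le)
    with P show "P \<in> {0..int m} \<times> {0..int m} \<times> {0..int m} \<times> {0..int m} \<times> {0..int m} \<times> {0..int m}"
      by (simp add: Pe hecke_params_def)
  qed
  then show ?thesis by (rule finite_subset) (intro finite_cartesian_product finite_atLeastAtMost_int)
qed

section \<open>The eigenvalue as a sum over representatives\<close>

lemma U_periodic_translate:
  assumes inv: "\<And>\<gamma> g. \<gamma> \<in> Gamma0 N \<Longrightarrow> g \<in> Sp4 \<Longrightarrow> \<phi> (\<gamma> ** g) = \<phi> g"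
    and cont: "continuous_on Sp4 \<phi>" and g: "g \<in> Sp4"
  shows "U_periodic (\<lambda>(x, s3, s2, s1). \<phi> (usym x s1 s2 s3 ** g))"
  unfolding U_periodic_def prod.case
proof (intro conjI allI)
  have "continuous_on UNIV (\<lambda>q. \<phi> (usym (fst q) (snd (snd (snd q))) (fst (snd (snd q))) (fst (snd q)) ** g))"
    unfolding usym_def
    by (rule continuous_on_compose2[OF cont])
       (auto intro!: continuous_intros Sp4_mult umat_Sp4 g)
  then show "continuous_on UNIV (\<lambda>(x, s3, s2, s1). \<phi> (usym x s1 s2 s3 ** g))"
    by (simp add: case_prod_unfold)
  have *: "\<phi> (usym (x + of_int n) (of_int a + s1 + 2 * of_int n * s2 + of_int n ^ 2 * s3)
       (of_int b + s2 + of_int n * s3) (of_int c + s3) ** g) = \<phi> (usym x s1 s2 s3 ** g)" for n a b c x s1 s2 s3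
    using inv[OF usym_int_Gamma0[of n a b c N] Sp4_mult[OF usym_Sp4 g, of x s1 s2 s3]]
    by (simp only: matrix_mul_assoc usym_mult_usym)
  fix x s3 s2 s1 :: real
  show "\<phi> (usym x (s1 + 1) s2 s3 ** g) = \<phi> (usym x s1 s2 s3 ** g)"
    using *[of x 0 1 s1 s2 s3 0 0] by (simp add: add_ac)
  show "\<phi> (usym x s1 (s2 + 1) s3 ** g) = \<phi> (usym x s1 s2 s3 ** g)"
    using *[of x 0 0 s1 s2 s3 1 0] by (simp add: add_ac)
  show "\<phi> (usym x s1 s2 (s3 + 1) ** g) = \<phi> (usym x s1 s2 s3 ** g)"
    using *[of x 0 0 s1 s2 s3 0 1] by (simp add: add_ac)
  show "\<phi> (usym (x + 1) (s1 + 2 * s2 + s3) (s2 + s3) s3 ** g) = \<phi> (usym x s1 s2 s3 ** g)"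
    using *[of x 1 0 s1 s2 s3 0 0] by (simp add: add_ac)
qed

lemma matrix_mul_scaleR_left: "(c *\<^sub>R A) ** B = c *\<^sub>R (A ** B)" for A B :: "real^4^4"
  by (simp add: matrix_matrix_mult_def vec_eq_iff sum_distrib_left mult.assoc)

lemma twisted_box_sum:
  assumes "finite I" "\<And>i. i \<in> I \<Longrightarrow> continuous_on UNIV (F i)"
  shows "twisted_box L (\<lambda>q. \<Sum>i\<in>I. F i q) = (\<Sum>i\<in>I. twisted_box L (F i))"
proof -
  define G where "G = (\<lambda>i (q :: real \<times> real \<times> real \<times> real). F i q * (ee (- fst q) * ee (- fst (snd q))))"
  have tb: "twisted_box L H = integral (cbox (0,0,0,0) (real L, real L, real L, real L))
      (\<lambda>q. H q * (ee (- fst q) * ee (- fst (snd q))))" for H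
    by (simp add: twisted_box_def case_prod_unfold)
  have "G i integrable_on cbox (0,0,0,0) (real L, real L, real L, real L)" if "i \<in> I" for i
    unfolding G_def by (rule integrable_continuous)
      (intro continuous_intros continuous_on_subset[OF assms(2)[OF that] subset_UNIV])
  from integral_sum[OF assms(1) this] show ?thesis
    unfolding tb G_def sum_distrib_right .
qed

text \<open>
  Evaluating the Fourier coefficient of frequency \<open>M\<close> at \<open>\<iota>(y\<^sub>1/M\<^sub>1, y\<^sub>2/M\<^sub>2)\<close> gives a Whittaker value that no
  longer depends on \<open>M\<close>.
\<close>

lemma fourier_coef_whittaker:
  assumes inv: "\<And>\<gamma> g. \<gamma> \<in> Gamma0 N \<Longrightarrow> g \<in> Sp4 \<Longrightarrow> \<phi> (\<gamma> ** g) = \<phi> g"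
    and cont: "continuous_on Sp4 \<phi>" and A: "fourier_coefficients W \<phi> A"
    and M: "M1 > 0" "M2 > 0" and y: "y1 > 0" "y2 > 0"
  shows "fourier_coef (\<lambda>(x, s3, s2, s1). \<phi> (usym x s1 s2 s3 ** iota (1 / real M1 * y1) (1 / real M2 * y2))) M1 M2 =
     A M1 M2 / complex_of_real (real M1 ^ 2 * real M2 powr (3/2)) * W (iota y1 y2)"
proof -
  let ?g = "iota (1 / real M1 * y1) (1 / real M2 * y2)"
  have pos: "1 / real M1 * y1 > 0" "1 / real M2 * y2 > 0" using M y by simp_all
  have "fourier_coef (\<lambda>(x, s3, s2, s1). \<phi> (usym x s1 s2 s3 ** ?g)) M1 M2 =
      U_integral (\<lambda>u. \<phi> (u ** ?g) * cnj (theta M1 M2 u))"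
    by (rule U_integral_eq_fourier_coef[symmetric, OF U_periodic_translate[OF inv cont iota_Sp4[OF pos]]]) auto
  also have "\<dots> = U_integral (\<lambda>u. \<phi> (u ** (mat 1 ** ?g ** mat 1)) * cnj (theta M1 M2 u))"
    by simp
  also have "mat 1 \<in> Ugrp" unfolding Ugrp_def umat_0[symmetric] by blast
  then have "U_integral (\<lambda>u. \<phi> (u ** (mat 1 ** ?g ** mat 1)) * cnj (theta M1 M2 u)) =
     A M1 M2 / complex_of_real (real M1 ^ 2 * real M2 powr (3/2)) * theta M1 M2 (mat 1) *
        W (iota (real M1) (real M2) ** ?g)"
    using A[unfolded fourier_coefficients_def, rule_format, OF M _ pos mat_1_Kgrp] by blast
  also have "theta M1 M2 (mat 1) = 1" unfolding umat_0[symmetric] theta_umat by simp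
  also have "iota (real M1) (real M2) ** ?g = iota y1 y2" using M by (simp add: iota_mult)
  finally show ?thesis by simp
qed

text \<open>
  The contribution of a representative to the eigenvalue, with \<open>W(\<iota>(y))\<close> divided out.
\<close>

definition hecke_weight :: "nat \<Rightarrow> (nat \<Rightarrow> nat \<Rightarrow> complex) \<Rightarrow> hpar \<Rightarrow> complex"
  where "hecke_weight m A = (\<lambda>(a1, a2, a, b1, b2, b3). if a1 dvd a2 \<and> a2 ^ 2 dvd int m then
     ee (of_int a / of_int a1) * ee (of_int b3 / of_int a2 ^ 2) *
     (A (nat (a2 div a1)) (nat (int m div a2 ^ 2)) /
      complex_of_real (real (nat (a2 div a1)) ^ 2 * real (nat (int m div a2 ^ 2)) powr (3/2))) else 0)"

lemma Ints_divide_iff: "b \<noteq> 0 \<Longrightarrow> (of_int a / of_int b :: real) \<in> \<int> \<longleftrightarrow> b dvd a"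
proof
  assume b: "b \<noteq> 0" and "(of_int a / of_int b :: real) \<in> \<int>"
  then obtain k where "of_int a / of_int b = (of_int k :: real)" by (elim Ints_cases)
  with b have "(of_int a :: real) = of_int (b * k)" by (simp add: field_simps)
  then show "b dvd a" by (simp only: of_int_eq_iff) simp
qed (metis Ints_of_int real_of_int_div)

lemma twisted_box_hecke_term:
  assumes inv: "\<And>\<gamma> g. \<gamma> \<in> Gamma0 N \<Longrightarrow> g \<in> Sp4 \<Longrightarrow> \<phi> (\<gamma> ** g) = \<phi> g"
    and cont: "continuous_on Sp4 \<phi>" and A: "fourier_coefficients W \<phi> A"
    and y: "y1 > 0" "y2 > 0" and m: "m > 0" and P: "P \<in> hecke_params m"
  defines "F \<equiv> \<lambda>(x, s3, s2, s1). ext \<phi> (map_mat of_int (hecke_mat m P) ** (usym x s1 s2 s3 ** iota y1 y2))"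
  shows "twisted_box m F = of_nat m ^ 4 * (hecke_weight m A P * W (iota y1 y2))" "continuous_on UNIV F"
proof -
  obtain a1 a2 a b1 b2 b3 where Pe: "P = (a1, a2, a, b1, b2, b3)" by (cases P)
  from P have pos: "a1 > 0" "a2 > 0" and dvd: "a2 dvd int m" by (auto simp: Pe hecke_params_def)
  define H where "H = hecke_rep (real m) (of_int a1) (of_int a2) (of_int a) (of_int b1) (of_int b2) (of_int b3)"
  have H: "map_mat of_int (hecke_mat m P) = H" unfolding H_def Pe using hecke_mat_real[OF m] P Pe by simp
  have S: "hecke_mat m P \<in> Smat m" by (rule hecke_mat_Smat[OF m P])
  define t1 t2 where "t1 = real_of_int a1 / of_int a2" and "t2 = real_of_int a2 ^ 2 / real m"
  have t: "t1 > 0" "t2 > 0" using pos m by (simp_all add: t1_def t2_def)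
  \<comment> \<open>The diagonal part \<open>\<iota>(t1, t2)\<close> of \<open>h/\<surd>m\<close> is absorbed into \<open>y\<close>.\<close>
  define f where "f = (\<lambda>(x, s3, s2, s1). \<phi> (usym x s1 s2 s3 ** iota (t1 * y1) (t2 * y2)))"
  have f: "U_periodic f" unfolding f_def
    by (rule U_periodic_translate[OF inv cont iota_Sp4]) (use t y in simp_all)
  have F: "F (x, s3, s2, s1) = f (of_int a / of_int a2 + t1 * x,
        of_int b3 / real m + t2 * s3,
        of_int b2 / real m + of_int a1 * of_int a2 / real m * s2 + of_int a * of_int a2 / real m * s3,
        of_int b1 / real m + of_int a1 ^ 2 / real m * s1 + 2 * of_int a * of_int a1 / real m * s2 + of_int a ^ 2 / real m * s3)"
      for x s3 s2 s1
  proof -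
    have u: "usym x s1 s2 s3 ** iota y1 y2 \<in> Sp4" by (intro Sp4_mult usym_Sp4 iota_Sp4 y)
    have "F (x, s3, s2, s1) = \<phi> (((1 / sqrt (real m)) *\<^sub>R (H ** usym x s1 s2 s3)) ** iota y1 y2)"
      using multiplier_Smat[OF S u]
      by (simp add: F_def ext_def H matrix_mul_assoc matrix_mul_scaleR_left)
    also have "\<dots> = f (of_int a / of_int a2 + t1 * x,
        of_int b3 / real m + t2 * s3,
        of_int b2 / real m + of_int a1 * of_int a2 / real m * s2 + of_int a * of_int a2 / real m * s3,
        of_int b1 / real m + of_int a1 ^ 2 / real m * s1 + 2 * of_int a * of_int a1 / real m * s2 + of_int a ^ 2 / real m * s3)"
      unfolding H_def f_def prod.case t1_def t2_def iota_mult[symmetric]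
      by (subst hecke_rep_mult_usym) (use m pos in \<open>simp_all add: matrix_mul_assoc\<close>)
    finally show ?thesis .
  qed
  show "continuous_on UNIV F"
  proof -
    have "continuous_on UNIV (\<lambda>q::real\<times>real\<times>real\<times>real. F (fst q, fst (snd q), fst (snd (snd q)), snd (snd (snd q))))"
      unfolding F by (intro continuous_intros U_periodic_cont'[OF f])
    then show ?thesis by simp
  qed
  have pos': "real_of_int a1 > 0" "real_of_int a2 > 0" "real m > 0" using pos m by simp_all
  have N: "t1 * real m = real (nat (a1 * (int m div a2)))" "of_int a1 ^ 2 / real m * real m = real (nat (a1 ^ 2))"
     "of_int a1 * of_int a2 / real m * real m = real (nat (a1 * a2))" "t2 * real m = real (nat (a2 ^ 2))"
  proof -
    have "0 \<le> a1 * (int m div a2)" using pos by (simp add: pos_imp_zdiv_nonneg_iff)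
    then have "real (nat (a1 * (int m div a2))) = of_int (a1 * (int m div a2))" by (rule of_nat_nat)
    then show "t1 * real m = real (nat (a1 * (int m div a2)))"
      by (simp add: t1_def real_of_int_div[OF dvd])
  qed (use pos m in \<open>simp_all add: t2_def\<close>)
  have A0: "real_of_int a1 ^ 2 / real m > 0" "real_of_int a1 * of_int a2 / real m > 0" using pos' by simp_all
  show "twisted_box m F = of_nat m ^ 4 * (hecke_weight m A P * W (iota y1 y2))"
  proof (cases "a1 dvd a2 \<and> a2 ^ 2 dvd int m")
    case True
    define M1 M2 where "M1 = nat (a2 div a1)" and "M2 = nat (int m div a2 ^ 2)"
    have "0 < a2 div a1" "0 < int m div a2 ^ 2"
      using True pos m by (simp_all add: pos_imp_zdiv_pos_iff zdvd_imp_le)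
    then have M: "M1 > 0" "M2 > 0" and rM: "real M1 = of_int (a2 div a1)" "real M2 = of_int (int m div a2 ^ 2)"
      by (simp_all add: M1_def M2_def)
    have rM': "real M1 = of_int a2 / of_int a1" "real M2 = real m / of_int a2 ^ 2"
      unfolding rM using real_of_int_div True by auto
    have tM: "t1 = 1 / real M1" "t2 = 1 / real M2" unfolding rM' t1_def t2_def using pos m by simp_all
    have "twisted_box m F = of_nat m ^ 4 * (ee (real M1 * (of_int a / of_int a2)) * ee (real M2 * (of_int b3 / real m)) * fourier_coef f M1 M2)"
      by (rule twisted_box_coef[OF f F m t(1) A0 t(2) N M tM])
    also have "real M1 * (of_int a / of_int a2) = of_int a / of_int a1"
      unfolding rM' using pos m by (simp add: field_simps)
    also have "real M2 * (of_int b3 / real m) = of_int b3 / of_int a2 ^ 2"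
      unfolding rM' using pos m by (simp add: field_simps)
    also have "fourier_coef f M1 M2 = A M1 M2 / complex_of_real (real M1 ^ 2 * real M2 powr (3/2)) * W (iota y1 y2)"
      unfolding f_def tM by (rule fourier_coef_whittaker[OF inv cont A M y])
    finally show ?thesis using True by (simp add: Pe hecke_weight_def M1_def[symmetric] M2_def[symmetric])
  next
    case False
    have "1 / t1 = of_int a2 / of_int a1" "1 / t2 = of_int (int m) / of_int (a2 ^ 2)"
      using pos m by (simp_all add: t1_def t2_def)
    then have "1 / t1 \<notin> \<int> \<or> 1 / t2 \<notin> \<int>"
      using False pos Ints_divide_iff[of a1 a2] Ints_divide_iff[of "a2 ^ 2" "int m"] by (auto simp del: of_int_power of_int_of_nat_eq)
    then have "twisted_box m F = 0" by (rule twisted_box_0[OF f F m t(1) A0 t(2) N])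
    then show ?thesis unfolding Pe hecke_weight_def prod.case if_not_P[OF False] by simp
  qed
qed

text \<open>
  The eigenvalue equation makes the whole sum over the representatives \<open>U(\<int>)\<close>-invariant, so its \<open>\<theta>\<close>-coefficient
  may be computed on the cube of side \<open>m\<close>, where the terms can be evaluated one by one.
\<close>

theorem hecke_eigenvalue_sum:
  assumes inv: "\<And>\<gamma> g. \<gamma> \<in> Gamma0 N \<Longrightarrow> g \<in> Sp4 \<Longrightarrow> \<phi> (\<gamma> ** g) = \<phi> g"
    and cont: "continuous_on Sp4 \<phi>" and A: "fourier_coefficients W \<phi> A" "A 1 1 = 1"
    and W: "\<And>x g k. x \<in> Ugrp \<Longrightarrow> g \<in> Sp4 \<Longrightarrow> k \<in> Kgrp \<Longrightarrow> W (x ** g ** k) = theta 1 1 x * W g" "g0 \<in> Sp4" "W g0 \<noteq> 0"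
    and m: "m > 0" and eig: "hecke_eigenvalue m \<phi> l"
  shows "l = (\<Sum>P\<in>hecke_params m. hecke_weight m A P)"
proof -
  obtain x y1 y2 k where g0: "x \<in> Ugrp" "y1 > 0" "y2 > 0" "k \<in> Kgrp" "g0 = x ** iota y1 y2 ** k"
    using iwasawa[OF W(2)] by blast
  note y = g0(2,3)
  have W0: "W (iota y1 y2) \<noteq> 0"
    using W(3) W(1)[OF g0(1) iota_Sp4[OF y] g0(4)] g0(5) by auto
  define f where "f = (\<lambda>(x, s3, s2, s1). \<phi> (usym x s1 s2 s3 ** iota y1 y2))"
  have f: "U_periodic f" unfolding f_def by (rule U_periodic_translate[OF inv cont iota_Sp4[OF y]])
  define F where "F = (\<lambda>P (x, s3, s2, s1). ext \<phi> (map_mat of_int (hecke_mat m P) ** (usym x s1 s2 s3 ** iota y1 y2)))"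
  have eq: "l * f q = (\<Sum>P\<in>hecke_params m. F P q)" for q
  proof -
    obtain x s3 s2 s1 where q: "q = (x, s3, s2, s1)" by (cases q)
    have "usym x s1 s2 s3 ** iota y1 y2 \<in> Sp4" by (intro Sp4_mult usym_Sp4 iota_Sp4 y)
    then have "l * f q = (\<Sum>h\<in>Hset m. ext \<phi> (map_mat of_int h ** (usym x s1 s2 s3 ** iota y1 y2)))"
      using eig by (simp add: hecke_eigenvalue_def hecke_op_def q f_def)
    also have "\<dots> = (\<Sum>P\<in>hecke_params m. F P q)"
      unfolding Hset_eq[OF m] F_def q by (simp add: sum.reindex[OF inj_on_hecke_mat[OF m]])
    finally show ?thesis .
  qed
  have f1: "f = (\<lambda>(x, s3, s2, s1). f (0 + 1 * x, 0 + 1 * s3, 0 + 1 * s2 + 0 * s3, 0 + 1 * s1 + 0 * s2 + 0 * s3))"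
    by auto
  \<comment> \<open>The identity map is the case of slopes 1, for which the cube of side \<open>m\<close> contains \<open>m\<^sup>4\<close> unit cubes.\<close>
  have "twisted_box m f = of_nat m ^ 4 * (ee (real 1 * 0) * ee (real 1 * 0) * fourier_coef f 1 1)"
    by (rule twisted_box_coef[OF f _ m, where ?\<alpha>0.0=1 and ?\<alpha>1.0=1 and ?\<alpha>2.0=1 and ?\<alpha>3.0=1 and ?\<gamma>=0 and ?\<gamma>1.0=0 and ?\<gamma>2.0=0
        and ?\<beta>1.0=0 and ?\<beta>2.0=0 and ?N0.0=m and ?N1.0=m and ?N2.0=m and ?N3.0=m]) auto
  also have "fourier_coef f 1 1 = W (iota y1 y2)"
    using fourier_coef_whittaker[OF inv cont A(1) zero_less_one zero_less_one y] A(2) by (simp add: f_def)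
  finally have box: "twisted_box m f = of_nat m ^ 4 * W (iota y1 y2)" by simp
  have "l * twisted_box m f = twisted_box m (\<lambda>q. l * f q)"
    unfolding twisted_box_def by (simp add: case_prod_unfold mult.assoc)
  also have "\<dots> = (\<Sum>P\<in>hecke_params m. twisted_box m (F P))"
    unfolding eq F_def
    by (rule twisted_box_sum[OF finite_hecke_params[OF m] twisted_box_hecke_term(2)[OF inv cont A(1) y m]])
  also have "\<dots> = (\<Sum>P\<in>hecke_params m. of_nat m ^ 4 * (hecke_weight m A P * W (iota y1 y2)))"
    unfolding F_def by (intro sum.cong refl twisted_box_hecke_term(1)[OF inv cont A(1) y m])
  also have "\<dots> = of_nat m ^ 4 * W (iota y1 y2) * (\<Sum>P\<in>hecke_params m. hecke_weight m A P)"
    unfolding sum_distrib_left by (intro sum.cong refl) (simp only: mult_ac)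
  finally show ?thesis using W0 m by (simp add: box)
qed

section \<open>Exponential sums over the representatives\<close>

lemma sum_ee_complete:
  fixes q K :: int
  assumes q: "q > 0" and K: "q dvd K" "K \<ge> 0"
  shows "(\<Sum>k\<in>{0..<K}. ee (of_int k / of_int q)) = (if q = 1 then of_int K else 0)"
proof (cases "q = 1")
  case True
  then show ?thesis using K by simp
next
  case False
  define z where "z = ee (1 / of_int q)"
  have "1 / of_int q \<notin> (\<int> :: real set)"
  proof
    assume "1 / of_int q \<in> (\<int> :: real set)"
    then obtain k where "1 / of_int q = (of_int k :: real)" by (elim Ints_cases)
    then have "(1 :: real) = of_int (q * k)" using q by (simp add: field_simps)
    then have "q * k = 1" by linarith
    then show False using False q by (metis zmult_eq_1_iff less_minus_one_simps(3) less_asym)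
  qed
  then have z: "z \<noteq> 1" by (simp add: z_def ee_eq_1_iff)
  obtain t where t: "K = q * t" using K by blast
  have "z ^ nat K = ee (of_int t)"
    using K q by (simp add: z_def ee_power t)
  then have zK: "z ^ nat K = 1" by simp
  have "(\<Sum>k\<in>{0..<K}. ee (of_int k / of_int q)) = (\<Sum>k<nat K. z ^ k)"
    by (rule sum.reindex_bij_witness[of _ int nat]) (auto simp: z_def ee_power)
  also have "\<dots> = 0" using z zK geometric_sum[OF z, of "nat K"] by simp
  finally show ?thesis using False by simp
qed

lemma sum_multiples:
  fixes n d :: int
  assumes "d > 0" "d dvd n"
  shows "(\<Sum>c\<in>{c\<in>{0..<n}. d dvd c}. f c) = (\<Sum>k\<in>{0..<n div d}. f (d * k))"
  by (rule sum.reindex_bij_witness[of _ "\<lambda>k. d * k" "\<lambda>c. c div d"])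
     (use assms in \<open>auto elim!: dvdE simp: mult_less_cancel_left_pos zero_le_mult_iff\<close>)

lemma card_residue:
  fixes n d k :: int
  assumes "d > 0" "d dvd n" "n \<ge> 0"
  shows "card {b\<in>{0..<n}. d dvd b - k} = nat (n div d)"
proof -
  define r where "r = k mod d"
  have r: "0 \<le> r" "r < d" using assms by (simp_all add: r_def)
  have dv: "d dvd b - k \<longleftrightarrow> d dvd b - r" for b
    unfolding r_def by (metis mod_diff_right_eq mod_0_imp_dvd dvd_imp_mod_0)
  have "bij_betw (\<lambda>t. d * t + r) {0..<n div d} {b\<in>{0..<n}. d dvd b - k}"
  proof (rule bij_betw_byWitness[of _ "\<lambda>b. b div d"])
    show "\<forall>t\<in>{0..<n div d}. (d * t + r) div d = t" using r by simp
    have *: "b = d * (b div d) + r" if "d dvd b - r" for b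
    proof -
      have "b mod d = r" using that r by (metis mod_eq_dvd_iff mod_pos_pos_trivial)
      then show ?thesis by (metis mult_div_mod_eq)
    qed
    then show "\<forall>b\<in>{b\<in>{0..<n}. d dvd b - k}. d * (b div d) + r = b" unfolding dv by simp
    show "(\<lambda>t. d * t + r) ` {0..<n div d} \<subseteq> {b\<in>{0..<n}. d dvd b - k}"
    proof (clarsimp simp: dv)
      fix t assume t: "0 \<le> t" "t < n div d"
      then have "d * (t + 1) \<le> d * (n div d)" using assms by (intro mult_left_mono) auto
      also have "d * (n div d) = n" using assms by simp
      finally show "0 \<le> d * t + r \<and> d * t + r < n" using t r assms by (simp add: algebra_simps)
    qed
    show "(\<lambda>b. b div d) ` {b\<in>{0..<n}. d dvd b - k} \<subseteq> {0..<n div d}"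
    proof (clarsimp simp: dv)
      fix b assume b: "0 \<le> b" "b < n" "d dvd b - r"
      have "d * (b div d) \<le> b" using *[OF b(3)] r by linarith
      also have "b < d * (n div d)" using b assms by simp
      finally have "b div d < n div d" using assms(1) by (rule mult_left_less_imp_less[OF _ less_imp_le])
      then show "0 \<le> b div d \<and> b div d < n div d" using assms b by (simp add: pos_imp_zdiv_nonneg_iff)
    qed
  qed
  from bij_betw_same_card[OF this] show ?thesis by simp
qed

text \<open>
  The Ramanujan sum \<open>c\<^sub>n(1)\<close>.
\<close>

definition ramanujan_sum :: "int \<Rightarrow> complex"
  where "ramanujan_sum n = (\<Sum>a\<in>{a\<in>{0..<n}. coprime a n}. ee (of_int a / of_int n))"

definition hecke_fiber :: "nat \<Rightarrow> int \<Rightarrow> int \<Rightarrow> hpar set"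
  where "hecke_fiber m n1 n2 = {P \<in> hecke_params m. fst P = n1 \<and> fst (snd P) = n2}"

text \<open>
  Here \<open>n1 = a\<^sub>1\<close>, \<open>n1 * f = a\<^sub>2\<close> and \<open>e = m/a\<^sub>2\<^sup>2\<close>.  Then \<open>D\<close> is automatically integral, and the congruences
  for \<open>BD\<close> say that \<open>b\<^sub>2\<close> and \<open>b\<^sub>3\<close> are multiples of \<open>a\<^sub>2\<close> subject to two congruences modulo \<open>a\<^sub>1\<close>.
\<close>

lemma hecke_params_iff:
  fixes e f n1 :: int
  assumes pos: "e > 0" "f > 0" "n1 > 0" and m: "int m = e * (n1 * f) ^ 2"
  shows "(n1, n1 * f, a, b1, b2, b3) \<in> hecke_params m \<longleftrightarrow>
     0 \<le> a \<and> a < n1 * f \<and> {b1, b2, b3} \<subseteq> {0..<int m} \<and>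
     (\<exists>c2 c3. b2 = n1 * f * c2 \<and> b3 = n1 * f * c3 \<and> n1 dvd a * c3 \<and> n1 dvd b1 - c2 * a)"
proof -
  have d1: "int m div n1 = e * n1 * f ^ 2" using pos by (simp add: m power2_eq_square)
  have d2: "int m div (n1 * f) = e * n1 * f" using pos by (simp add: m power2_eq_square)
  have d3: "a * (e * n1 * f) div n1 = a * e * f" using pos by simp
  have v: "n1 dvd int m" "n1 * f dvd int m" "n1 dvd a * (e * n1 * f)"
    by (simp_all add: m power2_eq_square)
  have b: "int m dvd b * (e * n1 * f) \<longleftrightarrow> n1 * f dvd b" for b
  proof -
    have "int m dvd b * (e * n1 * f) \<longleftrightarrow> (e * n1 * f) * (n1 * f) dvd (e * n1 * f) * b"
      by (simp add: m power2_eq_square mult_ac)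
    then show ?thesis using pos by simp
  qed
  have c3: "int m dvd (n1 * f * c2) * (e * n1 * f ^ 2) - (n1 * f * c3) * (a * e * f) \<longleftrightarrow> n1 dvd a * c3" for c2 c3
  proof -
    have "(n1 * f * c2) * (e * n1 * f ^ 2) - (n1 * f * c3) * (a * e * f) = (e * n1 * f ^ 2) * (n1 * (f * c2) - a * c3)"
      by (simp add: algebra_simps power2_eq_square)
    moreover have "int m = (e * n1 * f ^ 2) * n1" by (simp add: m power2_eq_square)
    ultimately have "?thesis \<longleftrightarrow> (n1 dvd n1 * (f * c2) - a * c3 \<longleftrightarrow> n1 dvd a * c3)"
      using pos by (simp only: dvd_mult_cancel_left) simp
    then show ?thesis by (simp add: dvd_diff_right_iff)
  qed
  have c1: "int m dvd b1 * (e * n1 * f ^ 2) - (n1 * f * c2) * (a * e * f) \<longleftrightarrow> n1 dvd b1 - c2 * a" for c2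
  proof -
    have "b1 * (e * n1 * f ^ 2) - (n1 * f * c2) * (a * e * f) = (e * n1 * f ^ 2) * (b1 - c2 * a)"
      by (simp add: algebra_simps power2_eq_square)
    moreover have "int m = (e * n1 * f ^ 2) * n1" by (simp add: m power2_eq_square)
    ultimately show ?thesis using pos by (simp only: dvd_mult_cancel_left) simp
  qed
  have n2: "n1 * f > 0" using pos by simp
  show ?thesis (is "?L \<longleftrightarrow> ?R")
  proof
    assume ?L
    then have r: "0 \<le> a \<and> a < n1 * f \<and> {b1, b2, b3} \<subseteq> {0..<int m}" and dv: "n1 * f dvd b2" "n1 * f dvd b3"
      and e: "int m dvd b2 * (e * n1 * f ^ 2) - b3 * (a * e * f)" "int m dvd b1 * (e * n1 * f ^ 2) - b2 * (a * e * f)"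
      unfolding hecke_params_def mem_Collect_eq prod.case d1 d2 d3 b by blast+
    from dv obtain c2 c3 where c: "b2 = n1 * f * c2" "b3 = n1 * f * c3" unfolding dvd_def by blast
    show ?R using r e unfolding c c1 c3 by blast
  next
    assume ?R
    then obtain c2 c3 where r: "0 \<le> a \<and> a < n1 * f \<and> {b1, b2, b3} \<subseteq> {0..<int m}"
      and c: "b2 = n1 * f * c2" "b3 = n1 * f * c3" and e: "n1 dvd a * c3" "n1 dvd b1 - c2 * a" by blast
    show ?L unfolding hecke_params_def mem_Collect_eq prod.case d1 d2 d3 b
      using r v e pos(3) n2 unfolding c c1 c3 by (simp only: dvd_triv_left simp_thms)
  qed
qed

text \<open>
  The factor of \<open>hecke_weight\<close> that varies when \<open>a\<^sub>1\<close> and \<open>a\<^sub>2\<close> are fixed.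
\<close>

definition hecke_phase :: "hpar \<Rightarrow> complex"
  where "hecke_phase = (\<lambda>(a1, a2, a, b1, b2, b3). ee (of_int a / of_int a1) * ee (of_int b3 / of_int a2 ^ 2))"

lemma finite_int_segment_filter: "finite {c :: int. 0 \<le> c \<and> c < k \<and> P c}"
  by (rule finite_subset[of _ "{0..<k}"]) auto

lemma sum_hecke_fiber_iterated:
  fixes e f n1 :: int
  assumes pos: "e > 0" "f > 0" "n1 > 0" and m: "int m = e * (n1 * f) ^ 2"
  shows "(\<Sum>P\<in>hecke_fiber m n1 (n1 * f). hecke_phase P) =
     (\<Sum>a\<in>{0..<n1 * f}. \<Sum>c3\<in>{c3\<in>{0..<e * (n1 * f)}. n1 dvd a * c3}. \<Sum>c2\<in>{0..<e * (n1 * f)}.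
        \<Sum>b1\<in>{b1\<in>{0..<int m}. n1 dvd b1 - c2 * a}. ee (of_int a / of_int n1) * ee (of_int c3 / of_int (n1 * f)))"
proof -
  define n2 where "n2 = n1 * f"
  have n2: "n2 > 0" using pos by (simp add: n2_def)
  have mn: "int m = n2 * (e * n2)" by (simp add: m n2_def power2_eq_square)
  have rg: "0 \<le> n2 * c \<and> n2 * c < int m \<longleftrightarrow> 0 \<le> c \<and> c < e * n2" for c
    unfolding mn using n2 by (simp add: zero_le_mult_iff)
  have "(\<Sum>P\<in>hecke_fiber m n1 n2. hecke_phase P) =
     (\<Sum>(a, c3, c2, b1)\<in>(SIGMA a:{0..<n2}. SIGMA c3:{c3\<in>{0..<e * n2}. n1 dvd a * c3}. SIGMA c2:{0..<e * n2}.
       {b1\<in>{0..<int m}. n1 dvd b1 - c2 * a}). ee (of_int a / of_int n1) * ee (of_int c3 / of_int n2))"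
  proof (rule sum.reindex_bij_witness[of _ "\<lambda>(a, c3, c2, b1). (n1, n2, a, b1, n2 * c2, n2 * c3)"
        "\<lambda>(a1, a2, a, b1, b2, b3). (a, b3 div n2, b2 div n2, b1)"])
    fix P assume P: "P \<in> hecke_fiber m n1 n2"
    then obtain a b1 b2 b3 where Pe: "P = (n1, n2, a, b1, b2, b3)" by (cases P) (auto simp: hecke_fiber_def)
    with P have "(n1, n1 * f, a, b1, b2, b3) \<in> hecke_params m" by (simp add: hecke_fiber_def n2_def)
    from this[unfolded hecke_params_iff[OF pos m]] obtain c2 c3 where
      r: "0 \<le> a" "a < n2" "{b1, b2, b3} \<subseteq> {0..<int m}"
      and c: "b2 = n2 * c2" "b3 = n2 * c3" "n1 dvd a * c3" "n1 dvd b1 - c2 * a" by (auto simp: n2_def)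
    have b: "b2 div n2 = c2" "b3 div n2 = c3" using n2 c by simp_all
    show "(case case P of (a1, a2, a, b1, b2, b3) \<Rightarrow> (a, b3 div n2, b2 div n2, b1) of (a, c3, c2, b1) \<Rightarrow>
        (n1, n2, a, b1, n2 * c2, n2 * c3)) = P"
      unfolding Pe prod.case b by (simp add: c)
    show "(case P of (a1, a2, a, b1, b2, b3) \<Rightarrow> (a, b3 div n2, b2 div n2, b1)) \<in>
      (SIGMA a:{0..<n2}. SIGMA c3:{c3\<in>{0..<e * n2}. n1 dvd a * c3}. SIGMA c2:{0..<e * n2}. {b1\<in>{0..<int m}. n1 dvd b1 - c2 * a})"
      unfolding Pe prod.case b using r c rg[of c2] rg[of c3] by simp
    show "(case case P of (a1, a2, a, b1, b2, b3) \<Rightarrow> (a, b3 div n2, b2 div n2, b1) of (a, c3, c2, b1) \<Rightarrow>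
        ee (of_int a / of_int n1) * ee (of_int c3 / of_int n2)) = hecke_phase P"
      unfolding Pe prod.case b hecke_phase_def using n2 by (simp add: c power2_eq_square)
  next
    fix Q assume Q: "Q \<in> (SIGMA a:{0..<n2}. SIGMA c3:{c3\<in>{0..<e * n2}. n1 dvd a * c3}. SIGMA c2:{0..<e * n2}.
       {b1\<in>{0..<int m}. n1 dvd b1 - c2 * a})"
    obtain a c3 c2 b1 where Qe: "Q = (a, c3, c2, b1)" by (cases Q)
    show "(case case Q of (a, c3, c2, b1) \<Rightarrow> (n1, n2, a, b1, n2 * c2, n2 * c3) of
        (a1, a2, a, b1, b2, b3) \<Rightarrow> (a, b3 div n2, b2 div n2, b1)) = Q"
      using n2 by (simp add: Qe)
    have "(n1, n1 * f, a, b1, n2 * c2, n2 * c3) \<in> hecke_params m"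
      unfolding hecke_params_iff[OF pos m] using Q rg[of c2] rg[of c3] by (auto simp: Qe n2_def)
    then show "(case Q of (a, c3, c2, b1) \<Rightarrow> (n1, n2, a, b1, n2 * c2, n2 * c3)) \<in> hecke_fiber m n1 n2"
      by (simp add: Qe hecke_fiber_def n2_def)
  qed
  also have "\<dots> = (\<Sum>a\<in>{0..<n2}. \<Sum>c3\<in>{c3\<in>{0..<e * n2}. n1 dvd a * c3}. \<Sum>c2\<in>{0..<e * n2}.
        \<Sum>b1\<in>{b1\<in>{0..<int m}. n1 dvd b1 - c2 * a}. ee (of_int a / of_int n1) * ee (of_int c3 / of_int n2))"
    by (simp add: sum.Sigma finite_int_segment_filter case_prod_unfold del: sum_constant)
  finally show ?thesis by (simp only: n2_def)
qed

text \<open>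
  The condition says that \<open>c\<close> is a multiple of \<open>d = n1 / gcd n1 a\<close>.  Over these \<open>c\<close> the sum consists of \<open>e\<close> complete
  sums over the roots of unity of order \<open>n1 * f / d\<close>, so it vanishes unless \<open>d = n1 * f\<close>.
\<close>

lemma sum_ee_annihilator:
  fixes n1 f e a :: int
  assumes pos: "e > 0" "f > 0" "n1 > 0"
  shows "(\<Sum>c\<in>{c\<in>{0..<e * (n1 * f)}. n1 dvd a * c}. ee (of_int c / of_int (n1 * f))) =
     (if f = 1 \<and> coprime a n1 then of_int e else 0)"
proof -
  define g where "g = gcd n1 a"
  define d where "d = n1 div g"
  have g: "g > 0" using pos by (simp add: g_def)
  have n1: "n1 = g * d" by (simp add: d_def g_def)
  have d: "d > 0" using pos g n1 by (simp add: zero_less_mult_iff)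
  obtain a' where a: "a = g * a'" by (metis g_def dvdE gcd_dvd2)
  have cop: "coprime d a'"
    using div_gcd_coprime[of n1 a] pos g unfolding g_def[symmetric] d_def[symmetric] by (simp add: a)
  have iff: "n1 dvd a * c \<longleftrightarrow> d dvd c" for c
    using g cop by (simp add: n1 a mult.assoc coprime_dvd_mult_right_iff)
  have N: "e * (n1 * f) = d * (e * (g * f))" by (simp add: n1)
  have "(\<Sum>c\<in>{c\<in>{0..<e * (n1 * f)}. n1 dvd a * c}. ee (of_int c / of_int (n1 * f))) =
     (\<Sum>k\<in>{0..<e * (g * f)}. ee (of_int (d * k) / of_int (n1 * f)))"
    unfolding iff N by (subst sum_multiples[OF d dvd_triv_left]) (use d in simp)
  also have "\<dots> = (\<Sum>k\<in>{0..<e * (g * f)}. ee (of_int k / of_int (g * f)))"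
    using d g pos by (intro sum.cong refl arg_cong[of _ _ ee]) (simp add: n1 field_simps)
  also have "\<dots> = (if g * f = 1 then of_int (e * (g * f)) else 0)"
    by (rule sum_ee_complete) (use g pos in auto)
  also have "g * f = 1 \<longleftrightarrow> f = 1 \<and> coprime a n1"
    using g pos by (auto simp: g_def coprime_iff_gcd_eq_1 gcd.commute zmult_eq_1_iff)
  finally show ?thesis by (auto simp: g_def coprime_iff_gcd_eq_1 gcd.commute)
qed

lemma sum_hecke_fiber:
  fixes e f n1 :: int
  assumes pos: "e > 0" "f > 0" "n1 > 0" and m: "int m = e * (n1 * f) ^ 2"
  shows "(\<Sum>P\<in>hecke_fiber m n1 (n1 * f). hecke_phase P) =
     (if f = 1 then of_int (e ^ 3 * n1 ^ 2) * ramanujan_sum n1 else 0)"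
proof -
  define n2 where "n2 = n1 * f"
  have b1: "card {b1\<in>{0..<int m}. n1 dvd b1 - k} = nat (e * n1 * f ^ 2)" for k
  proof -
    have "int m div n1 = e * n1 * f ^ 2" using pos by (simp add: m power2_eq_square)
    moreover have "n1 dvd int m" by (simp add: m power2_eq_square)
    ultimately show ?thesis using card_residue[of n1 "int m" k] pos(3) by simp
  qed
  \<comment> \<open>The number of choices of \<open>c2\<close> times the number of choices of \<open>b1\<close>, neither of which enters the phase.\<close>
  define w where "w = complex_of_int (e * n2 * (e * n1 * f ^ 2))"
  have "(\<Sum>P\<in>hecke_fiber m n1 n2. hecke_phase P) =
     (\<Sum>a\<in>{0..<n2}. \<Sum>c3\<in>{c3\<in>{0..<e * n2}. n1 dvd a * c3}.
        w * (ee (of_int a / of_int n1) * ee (of_int c3 / of_int n2)))"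
    unfolding n2_def sum_hecke_fiber_iterated[OF pos m] sum_constant b1 w_def
    using pos by (simp add: mult_ac)
  also have "\<dots> = (\<Sum>a\<in>{0..<n2}. w * ee (of_int a / of_int n1) * (if f = 1 \<and> coprime a n1 then of_int e else 0))"
    unfolding n2_def sum_ee_annihilator[OF pos, symmetric] by (simp add: sum_distrib_left mult.assoc)
  also have "\<dots> = (if f = 1 then of_int (e ^ 3 * n1 ^ 2) * ramanujan_sum n1 else 0)"
  proof (cases "f = 1")
    case True
    have "ramanujan_sum n1 = (\<Sum>a\<in>{0..<n1}. if coprime a n1 then ee (of_int a / of_int n1) else 0)"
      unfolding ramanujan_sum_def by (rule sum.inter_filter) simp
    moreover have "w * of_int e = of_int (e ^ 3 * n1 ^ 2)"
      by (simp add: w_def n2_def True power2_eq_square power3_eq_cube)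
    ultimately show ?thesis using True
      by (auto simp: n2_def sum_distrib_left mult_ac intro!: sum.cong)
  qed simp
  finally show ?thesis by (simp add: n2_def)
qed

lemma ramanujan_sum_1: "ramanujan_sum 1 = 1"
proof -
  have "{a\<in>{0..<1::int}. coprime a 1} = {0}" by auto
  then show ?thesis by (simp add: ramanujan_sum_def)
qed

lemma ramanujan_sum_prime_power:
  assumes p: "prime (p :: int)" and j: "j > 0"
  shows "ramanujan_sum (p ^ j) = (if j = 1 then -1 else 0)"
proof -
  have p1: "p > 1" using p by (rule prime_gt_1_int)
  obtain i where i: "j = Suc i" using j by (cases j) auto
  let ?h = "\<lambda>a. ee (of_int a / of_int (p ^ j))"
  have pj: "p ^ j > 1" using p1 j by (simp add: one_less_power)
  have cop: "coprime a (p ^ j) \<longleftrightarrow> \<not> p dvd a" for a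
  proof -
    have "coprime a p \<longleftrightarrow> \<not> p dvd a"
      using prime_imp_coprime[OF p, of a] coprime_common_divisor[of a p p] not_prime_unit[of p] p
      by (auto simp: coprime_commute)
    then show ?thesis using j by simp
  qed
  have "(\<Sum>a\<in>{0..<p ^ j}. ?h a) = ramanujan_sum (p ^ j) + (\<Sum>a\<in>{a\<in>{0..<p ^ j}. p dvd a}. ?h a)"
    unfolding ramanujan_sum_def cop
    by (subst sum.union_disjoint[symmetric]) (auto intro!: sum.cong finite_int_segment_filter)
  moreover have "(\<Sum>a\<in>{0..<p ^ j}. ?h a) = 0"
    using sum_ee_complete[of "p ^ j" "p ^ j"] pj by simp
  moreover have "(\<Sum>a\<in>{a\<in>{0..<p ^ j}. p dvd a}. ?h a) = (\<Sum>k\<in>{0..<p ^ i}. ee (of_int k / of_int (p ^ i)))"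
    using sum_multiples[of p "p ^ j" ?h] p1 by (simp add: i)
  moreover have "\<dots> = (if i = 0 then 1 else 0)"
  proof (cases "i = 0")
    case False
    then have "p ^ i > 1" using one_less_power[OF p1] by blast
    then have "p ^ i \<noteq> 1" "p ^ i > 0" by linarith+
    then show ?thesis using sum_ee_complete[of "p ^ i" "p ^ i"] False by simp
  qed simp
  ultimately show ?thesis by (auto simp: i add_eq_0_iff2)
qed

section \<open>Hecke eigenvalues at prime powers\<close>

lemma sum_hecke_weight_fiber:
  assumes n: "n1 > 0" "n2 > 0" and m: "m > 0"
  shows "(\<Sum>P\<in>hecke_fiber m (int n1) (int n2). hecke_weight m A P) =
    (if n1 = n2 \<and> n2 ^ 2 dvd m then complex_of_real (real (m div n2 ^ 2) powr (3/2) * real n2 ^ 2) *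
        ramanujan_sum (int n2) * A 1 (m div n2 ^ 2) else 0)"
proof (cases "n1 dvd n2 \<and> n2 ^ 2 dvd m")
  case False
  then have False': "\<not> (int n1 dvd int n2 \<and> int n2 ^ 2 dvd int m)"
    by (simp flip: of_nat_power)
  have zero: "hecke_weight m A P = 0" if fib: "P \<in> hecke_fiber m (int n1) (int n2)" for P
  proof -
    obtain a b1 b2 b3 where P: "P = (int n1, int n2, a, b1, b2, b3)"
      using fib by (cases P) (auto simp: hecke_fiber_def)
    show ?thesis unfolding P hecke_weight_def prod.case if_not_P[OF False'] by (rule refl)
  qed
  have off: "\<not> (n1 = n2 \<and> n2 ^ 2 dvd m)" using False by auto
  show ?thesis unfolding if_not_P[OF off] by (rule sum.neutral) (use zero in blast)
next
  case True
  then obtain f where f: "n2 = n1 * f" by blast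
  define e where "e = m div n2 ^ 2"
  have me: "m = e * n2 ^ 2" using True by (simp add: e_def)
  have pos: "int e > 0" "int f > 0" "int n1 > 0" using n m f me by auto
  have int_m: "int m = int e * (int n1 * int f) ^ 2" by (simp add: me f)
  have True': "int n1 dvd int n2 \<and> int n2 ^ 2 dvd int m"
    using True by (simp flip: of_nat_power)
  have quot: "nat (int n2 div int n1) = f" "nat (int m div int n2 ^ 2) = e"
    using n by (simp_all add: f me)
  define K where "K = A f e / complex_of_real (real f ^ 2 * real e powr (3/2))"
  have "hecke_weight m A P = hecke_phase P * K" if fib: "P \<in> hecke_fiber m (int n1) (int n2)" for P
  proof -
    obtain a b1 b2 b3 where P: "P = (int n1, int n2, a, b1, b2, b3)"
      using fib by (cases P) (auto simp: hecke_fiber_def)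
    show ?thesis
      unfolding P hecke_weight_def hecke_phase_def prod.case if_P[OF True'] quot K_def by simp
  qed
  then have "(\<Sum>P\<in>hecke_fiber m (int n1) (int n2). hecke_weight m A P) =
     (\<Sum>P\<in>hecke_fiber m (int n1) (int n1 * int f). hecke_phase P) * K"
    by (simp add: sum_distrib_right f)
  also have "\<dots> = (if f = 1 then of_nat (e ^ 3 * n1 ^ 2) * ramanujan_sum (int n1) * K else 0)"
    unfolding sum_hecke_fiber[OF pos int_m] by simp
  also have "\<dots> = (if n1 = n2 \<and> n2 ^ 2 dvd m then complex_of_real (real e powr (3/2) * real n2 ^ 2) *
        ramanujan_sum (int n2) * A 1 e else 0)"
  proof (cases "f = 1")
    case f1: True
    have "real e ^ 3 = real e powr (3/2) * real e powr (3/2)"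
      using pos(1) powr_realpow[of "real e" 3] powr_add[of "real e" "3/2" "3/2"] by simp
    then have "complex_of_nat (e ^ 3) = complex_of_real (real e powr (3/2)) * complex_of_real (real e powr (3/2))"
      by (metis of_nat_power of_real_mult of_real_of_nat_eq)
    then have "of_nat (e ^ 3 * n1 ^ 2) * ramanujan_sum (int n1) * K =
        complex_of_real (real e powr (3/2) * real n1 ^ 2) * ramanujan_sum (int n1) * A 1 e"
      unfolding K_def f1 of_nat_mult using pos(1) by simp
    then show ?thesis using True f1 by (simp add: f)
  next
    case False
    then have "n1 \<noteq> n2" using f n by simp
    then show ?thesis using False by simp
  qed
  finally show ?thesis by (simp only: e_def)
qed

text \<open>
  As \<open>ramanujan_sum n\<close> is the Moebius function, this is
  \<open>\<lambda>(m) = m\<^sup>3\<^sup>/\<^sup>2 \<Sum> \<mu>(n) n\<^sup>-\<^sup>1 A(1, m/n\<^sup>2)\<close> once it is combined with \<open>hecke_eigenvalue_sum\<close>.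
\<close>

lemma sum_hecke_weight:
  assumes m: "m > 0"
  shows "(\<Sum>P\<in>hecke_params m. hecke_weight m A P) =
    (\<Sum>n\<in>{n\<in>{1..m}. n ^ 2 dvd m}. complex_of_real (real (m div n ^ 2) powr (3/2) * real n ^ 2) *
        ramanujan_sum (int n) * A 1 (m div n ^ 2))"
proof -
  define t where "t = (\<lambda>n. complex_of_real (real (m div n ^ 2) powr (3/2) * real n ^ 2) *
        ramanujan_sum (int n) * A 1 (m div n ^ 2))"
  \<comment> \<open>Grouping the representatives by \<open>a\<^sub>1\<close> and \<open>a\<^sub>2\<close> leaves only the groups with \<open>a\<^sub>1 = a\<^sub>2\<close>.\<close>
  define diag where "diag = (\<lambda>P :: hpar. (nat (fst P), nat (fst (snd P))))"
  have sub: "diag ` hecke_params m \<subseteq> {1..m} \<times> {1..m}"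
  proof
    fix k assume "k \<in> diag ` hecke_params m"
    then obtain P where P: "P \<in> hecke_params m" "k = diag P" by blast
    obtain a1 a2 a b1 b2 b3 where Pe: "P = (a1, a2, a, b1, b2, b3)" by (cases P)
    have "a1 > 0" "a2 > 0" "a1 \<le> int m" "a2 \<le> int m"
      using P(1) m by (auto simp: Pe hecke_params_def intro!: zdvd_imp_le)
    then have "1 \<le> nat a1" "1 \<le> nat a2" "nat a1 \<le> m" "nat a2 \<le> m" by linarith+
    then show "k \<in> {1..m} \<times> {1..m}" by (simp add: P(2) diag_def Pe)
  qed
  have fib: "{P \<in> hecke_params m. diag P = (k1, k2)} = hecke_fiber m (int k1) (int k2)"
    if "k1 > 0" "k2 > 0" for k1 k2
    using that by (auto simp: hecke_fiber_def diag_def hecke_params_def nat_eq_iff)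
  have "(\<Sum>P\<in>hecke_params m. hecke_weight m A P) =
     (\<Sum>k\<in>{1..m} \<times> {1..m}. \<Sum>P\<in>{P \<in> hecke_params m. diag P = k}. hecke_weight m A P)"
    by (rule sum.group[symmetric, OF finite_hecke_params[OF m] _ sub]) simp
  also have "\<dots> = (\<Sum>(k1, k2)\<in>{1..m} \<times> {1..m}. if k1 = k2 then (if k2 ^ 2 dvd m then t k2 else 0) else 0)"
  proof (intro sum.cong refl)
    fix k assume "k \<in> {1..m} \<times> {1..m}"
    then obtain k1 k2 where k: "k = (k1, k2)" "k1 > 0" "k2 > 0" by auto
    show "(\<Sum>P\<in>{P \<in> hecke_params m. diag P = k}. hecke_weight m A P) =
        (case k of (k1, k2) \<Rightarrow> if k1 = k2 then (if k2 ^ 2 dvd m then t k2 else 0) else 0)"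
      unfolding k(1) prod.case fib[OF k(2,3)] sum_hecke_weight_fiber[OF k(2,3) m] t_def by simp
  qed
  also have "\<dots> = (\<Sum>k1\<in>{1..m}. if k1 ^ 2 dvd m then t k1 else 0)"
    by (simp add: sum.cartesian_product[symmetric])
  also have "\<dots> = (\<Sum>n\<in>{n\<in>{1..m}. n ^ 2 dvd m}. t n)"
    by (rule sum.inter_filter[symmetric]) simp
  finally show ?thesis by (simp only: t_def)
qed

text \<open>
  The Ramanujan sum of \<open>p\<^sup>j\<close> is \<open>1, -1, 0, 0, \<dots>\<close>, which leaves \<open>n = 1\<close> and \<open>n = p\<close>.
\<close>

lemma sum_hecke_weight_prime_power:
  assumes p: "prime p"
  shows "(\<Sum>P\<in>hecke_params (p ^ r). hecke_weight (p ^ r) A P) =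
     complex_of_real (real p powr (3 * real r / 2)) *
       (A 1 (p ^ r) - (if r \<ge> 2 then inverse (of_nat p) * A 1 (p ^ (r - 2)) else 0))"
proof -
  define m where "m = p ^ r"
  have p0: "p > 1" using p by (rule prime_gt_1_nat)
  have m: "m > 0" using p0 by (simp add: m_def)
  have pi: "prime (int p)" using p by simp
  define t where "t = (\<lambda>n. complex_of_real (real (m div n ^ 2) powr (3/2) * real n ^ 2) *
        ramanujan_sum (int n) * A 1 (m div n ^ 2))"
  have powr: "real (p ^ k) powr (3/2) = real p powr (3 * real k / 2)" for k
    using p0 by (simp add: powr_powr mult.commute flip: powr_realpow)
  have t1: "t 1 = complex_of_real (real p powr (3 * real r / 2)) * A 1 (p ^ r)"
    by (simp add: t_def m_def ramanujan_sum_1 powr[unfolded of_nat_power])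
  have tp: "t p = - (complex_of_real (real p powr (3 * real r / 2)) * (inverse (of_nat p) * A 1 (p ^ (r - 2))))"
    if r: "r \<ge> 2"
  proof -
    have d: "m div p ^ 2 = p ^ (r - 2)" using p0 r by (simp add: m_def power_diff)
    have "real (p ^ (r - 2)) powr (3/2) * real p ^ 2 = real p powr (3 * real (r - 2) / 2 + 2)"
      unfolding powr using p0 by (simp add: powr_add)
    also have "3 * real (r - 2) / 2 + 2 = 3 * real r / 2 - 1" using r by (simp add: field_simps)
    also have "real p powr (3 * real r / 2 - 1) = real p powr (3 * real r / 2) * inverse (real p)"
      using powr_diff[of "real p" "3 * real r / 2" 1] by (simp only: powr_one of_nat_0_le_iff divide_inverse)
    finally have scale: "real (p ^ (r - 2)) powr (3/2) * real p ^ 2 = real p powr (3 * real r / 2) * inverse (real p)" .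
    have "ramanujan_sum (int p) = - 1" using ramanujan_sum_prime_power[OF pi, of 1] by simp
    then show ?thesis unfolding t_def d scale by simp
  qed
  have "(\<Sum>P\<in>hecke_params m. hecke_weight m A P) = (\<Sum>n\<in>{n\<in>{1..m}. n ^ 2 dvd m}. t n)"
    unfolding t_def by (rule sum_hecke_weight[OF m])
  also have "\<dots> = (\<Sum>n\<in>(if r \<ge> 2 then {1, p} else {1}). t n)"
  proof (rule sum.mono_neutral_right)
    have "p ^ 2 dvd m" "p \<le> m" if "r \<ge> 2"
    proof -
      show "p ^ 2 dvd m" using that by (simp add: m_def le_imp_power_dvd)
      then have "p dvd m" by (metis dvd_trans dvd_triv_left power2_eq_square)
      then show "p \<le> m" using m by (rule dvd_imp_le)
    qed
    then show "(if r \<ge> 2 then {1, p} else {1}) \<subseteq> {n\<in>{1..m}. n ^ 2 dvd m}"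
      using m p0 by auto
    show "\<forall>n\<in>{n\<in>{1..m}. n ^ 2 dvd m} - (if r \<ge> 2 then {1, p} else {1}). t n = 0"
    proof
      fix n assume n: "n \<in> {n\<in>{1..m}. n ^ 2 dvd m} - (if r \<ge> 2 then {1, p} else {1})"
      then have nm: "n ^ 2 dvd p ^ r" by (simp add: m_def)
      then have "n dvd p ^ r" by (metis dvd_trans dvd_triv_left power2_eq_square)
      then obtain j where j: "n = p ^ j" using p by (auto simp: divides_primepow_nat)
      have "2 * j \<le> r" using nm p0 unfolding j power_mult[symmetric]
        by (simp add: power_dvd_imp_le mult.commute)
      then have "j > 1" using n by (cases "j = 0"; cases "j = 1") (auto simp: j split: if_splits)
      then show "t n = 0"
        using ramanujan_sum_prime_power[OF pi, of j] by (simp add: t_def j)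
    qed
  qed simp
  also have "\<dots> = complex_of_real (real p powr (3 * real r / 2)) *
       (A 1 (p ^ r) - (if r \<ge> 2 then inverse (of_nat p) * A 1 (p ^ (r - 2)) else 0))"
    using t1 tp p0 by (simp add: right_diff_distrib)
  finally show ?thesis by (simp only: m_def)
qed

theorem theorem6p2:
  fixes q p :: nat
    and V :: "aform set"
    and \<mu> :: "complex \<times> complex"
    and \<phi> W :: "real^4^4 \<Rightarrow> complex"
    and A :: "nat \<Rightarrow> nat \<Rightarrow> complex"
    and lam :: "nat \<Rightarrow> complex"
  assumes "prime q"
    and "irreducible_cuspidal_rep V"
    and "newform q \<mu> \<phi>" and "in_rep q \<phi> V"
    and "spherical_whittaker \<mu> W"
    and "fourier_coefficients W \<phi> A"
    and "A 1 1 = 1"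
    and "\<And>m. m > 0 \<Longrightarrow> coprime m q \<Longrightarrow> hecke_eigenvalue m \<phi> (lam m)"
    and "prime p" and "\<not> p dvd q"
  shows "lam p = complex_of_real (real p powr (3/2)) * A 1 p \<and>
    (\<forall>r\<ge>2. lam (p ^ r) = complex_of_real (real p powr (3 * real r / 2)) *
       (A 1 (p ^ r) - inverse (of_nat p) * A 1 (p ^ (r - 2))))"
proof -
  obtain N where N: "cusp_form N \<mu> \<phi>" using assms(3) by (auto simp: newform_def)
  have inv: "\<phi> (\<gamma> ** g) = \<phi> g" if "\<gamma> \<in> Gamma0 N" "g \<in> Sp4" for \<gamma> g
    using N that mat_1_Kgrp unfolding cusp_form_def by (metis matrix_mul_rid)
  have "smooth_fun Sp4 sp4_alg \<phi>" using N by (simp add: cusp_form_def)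
  from this[unfolded smooth_fun_def, rule_format, of "[]"] have cont: "continuous_on Sp4 \<phi>"
    by (simp add: Let_def)
  obtain g0 where g0: "g0 \<in> Sp4" "W g0 \<noteq> 0" using assms(5) by (auto simp: spherical_whittaker_def)
  have W: "W (x ** g ** k) = theta 1 1 x * W g" if "x \<in> Ugrp" "g \<in> Sp4" "k \<in> Kgrp" for x g k
    using assms(5) that by (simp add: spherical_whittaker_def)
  have lam: "lam (p ^ r) = complex_of_real (real p powr (3 * real r / 2)) *
       (A 1 (p ^ r) - (if r \<ge> 2 then inverse (of_nat p) * A 1 (p ^ (r - 2)) else 0))" for r
  proof -
    have m: "p ^ r > 0" using prime_gt_0_nat[OF assms(9)] by simp
    have "coprime (p ^ r) q"
      using prime_imp_coprime[OF assms(9,10)] by (simp add: coprime_power_left_iff)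
    note eig = assms(8)[OF m this]
    show ?thesis
      unfolding sum_hecke_weight_prime_power[OF assms(9), symmetric]
      by (rule hecke_eigenvalue_sum[OF inv cont assms(6,7) W g0 m eig])
  qed
  from lam[of 1] lam show ?thesis by simp
qed

end
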